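(* Let $0<\alpha<1$, let $\Omega=[x^1_{\min},x^1_{\max}]\times\cdots\times[x^m_{\min},x^m_{\max}]\subset\mathbb{R}^m$, and let $p\ge 0$. On differential $p$-forms on $\Omega$ with sufficiently smooth coefficients, the Caputo fractional exterior derivative $d_p^\alpha$ satisfies $$d_p^\alpha=\mathcal{I}^{1-\alpha}_{p+1}\, d_p\, {}^{RL}\mathcal{D}^{1-\alpha}_{p},$$ where $d_p$ is the usual exterior derivative, $\mathcal{I}^{\beta}_{p}$ is the Riemann-Liouville fractional integration operator on $p$-forms and ${}^{RL}\mathcal{D}^{\beta}_{p}$ is the Riemann-Liouville fractional differentiation operator on $p$-forms.
   Context: For a function $f:\Omega\to\mathbb{R}$, a coordinate index $j$ and $\beta>0$, the left-sided Riemann-Liouville partial fractional integral is $$I^{\beta}_{x^j}f(x^1,\dots,x^m)=\frac{1}{\Gamma(\beta)}\int_{x^j_{\min}}^{x^j}\frac{f(x^1,\dots,x^{j-1},x',x^{j+1},\dots,x^m)}{(x^j-x')^{1-\beta}}\,dx'.$$ Let $D^n_{x^j}$ be the $n$-th partial derivative with respect to $x^j$ (with $D_{x^j}=D^1_{x^j}$). With $n=\lfloor\beta\rfloor+1$, the Riemann-Liouville fractional partial derivative is ${}^{RL}D^{\beta}_{x^j}f=D^n_{x^j}I^{n-\beta}_{x^j}f$, and for non-integer $\beta>0$ the Caputo fractional partial derivative is ${}^{C}D^{\beta}_{x^j}f=I^{n-\beta}_{x^j}D^n_{x^j}f$. Let $\mathfrak{J}_{p,m}=\{J=(i_1,\dots,i_p):1\le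 i_1<\cdots<i_p\le m\}$ and $dx^J=dx^{i_1}\wedge\cdots\wedge dx^{i_p}$. Every $p$-form on $\Omega$ is written $\sum_{J\in\mathfrak{J}_{p,m}}a_J\,dx^J$ with real-valued functions $a_J$ on $\Omega$; $\Lambda^p$ denotes the space of $p$-forms. Define $$d_p\Big(\sum_J a_J dx^J\Big)=\sum_J\sum_{i=1}^m (D_{x^i}a_J)\,dx^i\wedge dx^J,\qquad d_p^\alpha\Big(\sum_J a_J dx^J\Big)=\sum_J\sum_{i=1}^m \big({}^{C}D^{\alpha}_{x^i}a_J\big)\,dx^i\wedge dx^J,$$ and, for $p\ge1$ and $\beta>0$, $$\mathcal{I}^{\beta}_{p}\Big(\sum_J a_J dx^J\Big)=\sum_{J=(i_1,\dots,i_p)}\big(I^{\beta}_{x^{i_1}}\cdots I^{\beta}_{x^{i_p}}a_J\big)dx^J,\qquad {}^{RL}\mathcal{D}^{\beta}_{p}\Big(\sum_J a_J dx^J\Big)=\sum_{J=(i_1,\dots,i_p)}\big({}^{RL}D^{\beta}_{x^{i_1}}\cdots {}^{RL}D^{\beta}_{x^{i_p}}a_J\big)dx^J,$$ while for $p=0$, $\mathcal{I}^{\beta}_{0}$ and ${}^{RL}\mathcal{D}^{\beta}_{0}$ are the identity.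
   Formalization: Equality of dx^K coefficients is claimed at points with x^k > x^k_min for all k in K, and on all of Ω only if each a_J vanishes on the faces x^j = x^j_min, j in J; as stated it fails there (ω = x^2 dx^1 at x^1 = x^1_min = 0). Smooth means C^{p+1}. *)

theory Defs
  imports "HOL-Analysis.Analysis"
begin

(* The coordinates x^1 < ... < x^m are indexed by a finite linearly ordered type 'm, and
   Omega is cbox lo hi.  Functions on Omega are total functions of which the operators
   below only use the values on Omega (when evaluated at points of Omega). *)

definition coord_upd :: "real^'m \<Rightarrow> 'm \<Rightarrow> real \<Rightarrow> real^'m" where
  "coord_upd x j t = (\<chi> k. if k = j then t else x $ k)"

(* Relative to the edge of the box through x, hence one-sided on the faces. *)
definition partial_deriv ::
    "real^'m \<Rightarrow> real^'m \<Rightarrow> 'm \<Rightarrow> (real^'m \<Rightarrow> real) \<Rightarrow> real^'m \<Rightarrow> real" where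
  "partial_deriv lo hi j f x =
     vector_derivative (\<lambda>t. f (coord_upd x j t)) (at (x $ j) within {lo $ j..hi $ j})"

definition RL_integral ::
    "real^'m \<Rightarrow> real \<Rightarrow> 'm \<Rightarrow> (real^'m \<Rightarrow> real) \<Rightarrow> real^'m \<Rightarrow> real" where
  "RL_integral lo \<beta> j f x =
     1 / Gamma \<beta> *
       integral {lo $ j..x $ j} (\<lambda>t. f (coord_upd x j t) / (x $ j - t) powr (1 - \<beta>))"

definition RL_deriv ::
    "real^'m \<Rightarrow> real^'m \<Rightarrow> real \<Rightarrow> 'm \<Rightarrow> (real^'m \<Rightarrow> real) \<Rightarrow> real^'m \<Rightarrow> real" where
  "RL_deriv lo hi \<beta> j f =
     (let n = nat \<lfloor>\<beta>\<rfloor> + 1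
      in (partial_deriv lo hi j ^^ n) (RL_integral lo (real n - \<beta>) j f))"

definition Caputo_deriv ::
    "real^'m \<Rightarrow> real^'m \<Rightarrow> real \<Rightarrow> 'm \<Rightarrow> (real^'m \<Rightarrow> real) \<Rightarrow> real^'m \<Rightarrow> real" where
  "Caputo_deriv lo hi \<beta> j f =
     (let n = nat \<lfloor>\<beta>\<rfloor> + 1
      in RL_integral lo (real n - \<beta>) j ((partial_deriv lo hi j ^^ n) f))"

(* Class C^k up to the boundary: all iterated partial derivatives of order at most k
   exist and are continuous on the closed box. *)
primrec Ck_on_box ::
    "nat \<Rightarrow> real^'m \<Rightarrow> real^'m \<Rightarrow> (real^'m \<Rightarrow> real) \<Rightarrow> bool" where
  "Ck_on_box 0 lo hi f \<longleftrightarrow> continuous_on (cbox lo hi) f"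
| "Ck_on_box (Suc k) lo hi f \<longleftrightarrow>
     continuous_on (cbox lo hi) f \<and>
     (\<forall>j. (\<forall>x\<in>cbox lo hi.
             (\<lambda>t. f (coord_upd x j t)) differentiable (at (x $ j) within {lo $ j..hi $ j})) \<and>
          Ck_on_box k lo hi (partial_deriv lo hi j f))"

definition incr_tuples :: "nat \<Rightarrow> ('m::{finite,linorder}) list set" where
  "incr_tuples p = {J. length J = p \<and> sorted_wrt (<) J}"

(* A p-form is given by its coefficients: \<omega> J is the function a_J in sum_J a_J dx^J,
   J ranging over incr_tuples p.  Values of \<omega> at other lists are irrelevant. *)
type_synonym 'm form = "'m list \<Rightarrow> real^'m \<Rightarrow> real"

(* The coefficient of dx^K (K strictly increasing) in dx^{l_1} /\ ... /\ dx^{l_r} for an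
   arbitrary list L = [l_1, ..., l_r]: zero if an index repeats, and otherwise the sign of
   the permutation that sorts L, computed from its number of inversions. *)
definition dx_coeff :: "('m::{finite,linorder}) list \<Rightarrow> 'm list \<Rightarrow> real" where
  "dx_coeff L K =
     (if distinct L \<and> sort L = K
      then (-1) ^ card {(a, b). a < b \<and> b < length L \<and> L ! b < L ! a}
      else 0)"

definition ext_deriv ::
    "real^'m::{finite,linorder} \<Rightarrow> real^'m::{finite,linorder} \<Rightarrow> nat \<Rightarrow> 'm form \<Rightarrow> 'm form" where
  "ext_deriv lo hi p \<omega> =
     (\<lambda>K x. \<Sum>J\<in>incr_tuples p. \<Sum>i\<in>UNIV. partial_deriv lo hi i (\<omega> J) x * dx_coeff (i # J) K)"

definition Caputo_ext_deriv ::
    "real^'m::{finite,linorder} \<Rightarrow> real^'m::{finite,linorder} \<Rightarrow> real \<Rightarrow> nat \<Rightarrow> 'm form \<Rightarrow> 'm form" where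
  "Caputo_ext_deriv lo hi \<alpha> p \<omega> =
     (\<lambda>K x. \<Sum>J\<in>incr_tuples p. \<Sum>i\<in>UNIV. Caputo_deriv lo hi \<alpha> i (\<omega> J) x * dx_coeff (i # J) K)"

(* foldr D [i_1, ..., i_p] a is D i_1 (... (D i_p a)); for p = 0 both operators leave the
   coefficient of the empty tuple, i.e. the 0-form, unchanged. *)
definition RL_form_integral ::
    "real^'m::{finite,linorder} \<Rightarrow> real \<Rightarrow> nat \<Rightarrow> 'm form \<Rightarrow> 'm form" where
  "RL_form_integral lo \<beta> p \<omega> =
     (\<lambda>J. if J \<in> incr_tuples p then foldr (RL_integral lo \<beta>) J (\<omega> J) else (\<lambda>x. 0))"

definition RL_form_deriv ::
    "real^'m::{finite,linorder} \<Rightarrow> real^'m::{finite,linorder} \<Rightarrow> real \<Rightarrow> nat \<Rightarrow> 'm form \<Rightarrow> 'm form" where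
  "RL_form_deriv lo hi \<beta> p \<omega> =
     (\<lambda>J. if J \<in> incr_tuples p then foldr (RL_deriv lo hi \<beta>) J (\<omega> J) else (\<lambda>x. 0))"

end

theory Submission
  imports Defs
begin

text \<open>Write \<open>I\<close> and \<open>D\<close> for the Riemann-Liouville integral and derivative of order \<open>1 - \<alpha>\<close>.  The
  formal argument is short: \<open>\<partial>\<^sub>i\<close> commutes with \<open>D\<^sub>j\<close> for \<open>j \<noteq> i\<close>, the operators \<open>I\<^sub>k\<close> commute with
  each other, and \<open>I\<^sub>j D\<^sub>j\<close> is the identity, so that for \<open>K = J \<union> {i}\<close> the term
  \<open>I\<^sub>K \<partial>\<^sub>i D\<^sub>J a\<^sub>J\<close> reduces to \<open>I\<^sub>i \<partial>\<^sub>i a\<^sub>J\<close>, the Caputo derivative.  The difficulty is that \<open>D\<^sub>j f\<close>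
  in general blows up like \<open>(x\<^sub>j - lo\<^sub>j)\<^bsup>\<alpha>-1\<^esup>\<close> at the face \<open>x\<^sub>j = lo\<^sub>j\<close> and does not exist on it.

  The proof therefore splits off the singular power.  The substitution
  \<open>t = lo\<^sub>j + s (x\<^sub>j - lo\<^sub>j)\<close> turns a fractional integral into an average over contractions of one
  coordinate, with respect to the Erdelyi-Kober measure
  \<open>s\<^bsup>a-1\<^esup> (1 - s)\<^bsup>b-1\<^esup> ds / \<Gamma>(b)\<close> on \<open>[0, 1]\<close>.  Such averages preserve continuity and
  smoothness up to the boundary, and an average in one coordinate commutes with averages (Fubini)
  and derivatives in the other coordinates.  Two facts carry the argument: \<open>D\<^sub>j f = (x\<^sub>j - lo\<^sub>j)\<^bsup>\<alpha>-1\<^esup> B\<^sub>j f\<close> where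
  \<open>B\<^sub>j f\<close> is the average, for \<open>a = 1\<close> and \<open>b = \<alpha>\<close>, of \<open>\<alpha> f + (x\<^sub>j - lo\<^sub>j) \<partial>\<^sub>j f\<close>
  (\<open>RL_deriv_eq_RL_avg\<close>), and \<open>I\<^sub>j ((x\<^sub>j - lo\<^sub>j)\<^bsup>\<alpha>-1\<^esup> h) = A\<^sub>j h\<close> off the face, where \<open>A\<^sub>j h\<close> is
  the average of \<open>h\<close> for \<open>a = \<alpha>\<close> and \<open>b = 1 - \<alpha>\<close> (\<open>RL_integral_powr\<close>).  Then \<open>A\<^sub>j B\<^sub>j f = f\<close>
  (\<open>dil_avg_RL_avg\<close>) by the semigroup law of the Erdelyi-Kober averages (\<open>EK_semigroup\<close>), which is
  a comparison of moments.

  On the points above the lower faces, the coefficient of \<open>dx\<^sup>K\<close> before the last integration is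
  the common weight \<open>\<Prod>\<^sub>k\<^sub>\<in>\<^sub>K (x\<^sub>k - lo\<^sub>k)\<^bsup>\<alpha>-1\<^esup>\<close> times the continuous function
  \<open>\<Sum> \<plusminus> (x\<^sub>i - lo\<^sub>i)\<^bsup>1-\<alpha>\<^esup> B\<^sub>J \<partial>\<^sub>i a\<^sub>J\<close>, to which \<open>I\<^sub>K\<close> applies as the linear operator
  \<open>A\<^sub>K\<close> (\<open>foldr_RL_integral\<close>), and each term is evaluated by commuting the averages
  (\<open>foldr_dil_avg_eq_Caputo_deriv\<close>).  On a lower face \<open>x\<^sub>k = lo\<^sub>k\<close> with \<open>k\<close> in \<open>K\<close> the right-hand
  side is an integral over a degenerate interval; if the coefficients \<open>a\<^sub>J\<close> vanish on the faces
  in \<open>J\<close>, so does the left-hand side.\<close>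

section \<open>Finite measures on the unit interval\<close>

text \<open>A finite measure whose space is the closed unit interval.  Carrying the Borel sets of
  \<open>[0, 1]\<close> rather than those of the line makes every function that is continuous on \<open>[0, 1]\<close>
  measurable, whatever its values outside.\<close>
definition unit_measure :: "real measure \<Rightarrow> bool" where
  "unit_measure M \<longleftrightarrow> finite_measure M \<and> sets M = sets (restrict_space borel {0..1})"

lemma unit_measure_finite: "unit_measure M \<Longrightarrow> finite_measure M"
  by (simp add: unit_measure_def)

lemma unit_measure_space:
  assumes "unit_measure M"
  shows "space M = {0..1}"
  using assms sets_eq_imp_space_eq[of M "restrict_space borel {0..1}"]
  by (simp add: unit_measure_def space_restrict_space)

lemma unit_measure_measurable:
  fixes \<phi> :: "real \<Rightarrow> real"
  assumes "unit_measure M" "continuous_on {0..1} \<phi>"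
  shows "\<phi> \<in> borel_measurable M"
proof -
  have "\<phi> \<in> borel_measurable (restrict_space borel {0..1})"
    using assms(2) by (rule borel_measurable_continuous_on_restrict)
  moreover have "(borel_measurable M :: (real \<Rightarrow> real) set) = borel_measurable (restrict_space borel {0..1})"
    using assms(1) by (intro measurable_cong_sets) (auto simp: unit_measure_def)
  ultimately show ?thesis by (simp only:)
qed

lemma unit_measure_integrable:
  fixes \<phi> :: "real \<Rightarrow> real"
  assumes M: "unit_measure M" and c: "continuous_on {0..1} \<phi>"
  shows "integrable M \<phi>"
proof -
  have "bounded (\<phi> ` {0..1})"
    using c by (intro compact_imp_bounded compact_continuous_image) auto
  then obtain B where "\<And>s. s \<in> {0..1} \<Longrightarrow> norm (\<phi> s) \<le> B"
    unfolding bounded_iff by blast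
  then show ?thesis
    using M c by (intro finite_measure.integrable_const_bound[where B = B])
      (auto simp: unit_measure_finite unit_measure_space unit_measure_measurable intro!: AE_I2)
qed

text \<open>Dominated convergence for a sequence of integrands that are continuous in the variable of
  integration and uniformly bounded.\<close>
lemma unit_measure_LIMSEQ:
  fixes \<phi> :: "nat \<Rightarrow> real \<Rightarrow> real"
  assumes M: "unit_measure M"
    and c: "\<And>n. continuous_on {0..1} (\<phi> n)" "continuous_on {0..1} \<psi>"
    and lim: "\<And>s. s \<in> {0..1} \<Longrightarrow> (\<lambda>n. \<phi> n s) \<longlonglongrightarrow> \<psi> s"
    and B: "\<And>n s. s \<in> {0..1} \<Longrightarrow> \<bar>\<phi> n s\<bar> \<le> B"
  shows "(\<lambda>n. \<integral>s. \<phi> n s \<partial>M) \<longlonglongrightarrow> (\<integral>s. \<psi> s \<partial>M)"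
proof (rule integral_dominated_convergence[where w = "\<lambda>_. B"])
  show "integrable M (\<lambda>_. B)"
    using M by (intro unit_measure_integrable) auto
qed (use assms in \<open>auto simp: unit_measure_measurable unit_measure_space intro!: AE_I2\<close>)

lemma continuous_on_unit_measure:
  fixes \<phi> :: "'a::metric_space \<Rightarrow> real \<Rightarrow> real"
  assumes M: "unit_measure M" and S: "compact S"
    and c: "continuous_on (S \<times> {0..1}) (\<lambda>(x, s). \<phi> x s)"
  shows "continuous_on S (\<lambda>x. \<integral>s. \<phi> x s \<partial>M)"
  unfolding continuous_on_sequentially
proof (intro allI ballI impI)
  fix X l assume l: "l \<in> S" and X: "(\<forall>n. X n \<in> S) \<and> X \<longlonglongrightarrow> l"
  have "bounded ((\<lambda>(x, s). \<phi> x s) ` (S \<times> {0..1}))"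
    using c S by (intro compact_imp_bounded compact_continuous_image) (auto intro: compact_Times)
  then obtain B where B: "\<And>x s. x \<in> S \<Longrightarrow> s \<in> {0..1} \<Longrightarrow> norm (\<phi> x s) \<le> B"
    unfolding bounded_iff by force
  have c1: "continuous_on {0..1} (\<phi> x)" if "x \<in> S" for x
    by (rule continuous_on_compose2[OF c, of _ "\<lambda>s. (x, s)", simplified])
      (use that in \<open>auto intro!: continuous_intros\<close>)
  have c2: "continuous_on S (\<lambda>x. \<phi> x s)" if "s \<in> {0..1}" for s
    by (rule continuous_on_compose2[OF c, of _ "\<lambda>x. (x, s)", simplified])
      (use that in \<open>auto intro!: continuous_intros\<close>)
  have "(\<lambda>n. \<integral>s. \<phi> (X n) s \<partial>M) \<longlonglongrightarrow> (\<integral>s. \<phi> l s \<partial>M)"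
  proof (rule unit_measure_LIMSEQ[OF M])
    show "(\<lambda>n. \<phi> (X n) s) \<longlonglongrightarrow> \<phi> l s" if "s \<in> {0..1}" for s
      using c2[OF that] l X unfolding continuous_on_sequentially by (auto simp: o_def)
    show "\<bar>\<phi> (X n) s\<bar> \<le> B" if "s \<in> {0..1}" for n s
      using B[OF _ that, of "X n"] X by simp
  qed (use l X c1 in auto)
  then show "((\<lambda>x. \<integral>s. \<phi> x s \<partial>M) \<circ> X) \<longlonglongrightarrow> (\<integral>s. \<phi> l s \<partial>M)"
    by (simp add: o_def)
qed

lemma has_real_derivative_unit_measure:
  fixes \<phi> \<phi>' :: "real \<Rightarrow> real \<Rightarrow> real"
  assumes M: "unit_measure M" and t: "t \<in> {a..b}"
    and d: "\<And>s t. s \<in> {0..1} \<Longrightarrow> t \<in> {a..b} \<Longrightarrow>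
              ((\<lambda>t. \<phi> s t) has_real_derivative \<phi>' s t) (at t within {a..b})"
    and c: "\<And>t. t \<in> {a..b} \<Longrightarrow> continuous_on {0..1} (\<lambda>s. \<phi> s t)"
    and c': "continuous_on ({0..1} \<times> {a..b}) (\<lambda>(s, t). \<phi>' s t)"
  shows "((\<lambda>t. \<integral>s. \<phi> s t \<partial>M) has_real_derivative (\<integral>s. \<phi>' s t \<partial>M)) (at t within {a..b})"
proof -
  have "bounded ((\<lambda>(s, t). \<phi>' s t) ` ({0..1} \<times> {a..b}))"
    using c' by (intro compact_imp_bounded compact_continuous_image) (auto intro: compact_Times)
  then obtain B where B: "\<And>s t. s \<in> {0..1} \<Longrightarrow> t \<in> {a..b} \<Longrightarrow> norm (\<phi>' s t) \<le> B"
    unfolding bounded_iff by force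
  have lip: "\<bar>\<phi> s u - \<phi> s t\<bar> \<le> B * \<bar>u - t\<bar>" if "s \<in> {0..1}" "u \<in> {a..b}" for s u
    using field_differentiable_bound[of "{a..b}" "\<phi> s" "\<phi>' s" B u t] d B that t by auto
  have "((\<lambda>u. ((\<integral>s. \<phi> s u \<partial>M) - (\<integral>s. \<phi> s t \<partial>M)) / (u - t)) \<longlongrightarrow> (\<integral>s. \<phi>' s t \<partial>M)) (at t within {a..b})"
    unfolding tendsto_at_iff_sequentially
  proof (intro allI impI)
    fix X assume X: "\<forall>i. X i \<in> {a..b} - {t}" "X \<longlonglongrightarrow> t"
    have "(\<lambda>n. \<integral>s. (\<phi> s (X n) - \<phi> s t) / (X n - t) \<partial>M) \<longlonglongrightarrow> (\<integral>s. \<phi>' s t \<partial>M)"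
    proof (rule unit_measure_LIMSEQ[OF M])
      show "continuous_on {0..1} (\<lambda>s. (\<phi> s (X n) - \<phi> s t) / (X n - t))" for n
        using X(1) t by (intro continuous_intros c) auto
      show "continuous_on {0..1} (\<lambda>s. \<phi>' s t)"
        by (rule continuous_on_compose2[OF c', of _ "\<lambda>s. (s, t)", simplified])
          (use t in \<open>auto intro!: continuous_intros\<close>)
      show "\<bar>(\<phi> s (X n) - \<phi> s t) / (X n - t)\<bar> \<le> B" if "s \<in> {0..1}" for n s
        using lip[OF that, of "X n"] X(1)[rule_format, of n] by (simp add: abs_divide divide_le_eq)
      show "(\<lambda>n. (\<phi> s (X n) - \<phi> s t) / (X n - t)) \<longlonglongrightarrow> \<phi>' s t" if "s \<in> {0..1}" for s
        using d[OF that t] X unfolding has_field_derivative_iff tendsto_at_iff_sequentially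
        by (auto simp: o_def)
    qed
    also have "(\<lambda>n. \<integral>s. (\<phi> s (X n) - \<phi> s t) / (X n - t) \<partial>M) =
        (\<lambda>u. ((\<integral>s. \<phi> s u \<partial>M) - (\<integral>s. \<phi> s t \<partial>M)) / (u - t)) \<circ> X"
    proof
      fix n
      have "integrable M (\<lambda>s. \<phi> s (X n))" "integrable M (\<lambda>s. \<phi> s t)"
        using M X(1) t by (auto intro!: unit_measure_integrable c)
      then show "(\<integral>s. (\<phi> s (X n) - \<phi> s t) / (X n - t) \<partial>M) =
        ((\<lambda>u. ((\<integral>s. \<phi> s u \<partial>M) - (\<integral>s. \<phi> s t \<partial>M)) / (u - t)) \<circ> X) n"
        by (simp add: Bochner_Integration.integral_diff)
    qed
    finally show "((\<lambda>u. ((\<integral>s. \<phi> s u \<partial>M) - (\<integral>s. \<phi> s t \<partial>M)) / (u - t)) \<circ> X) \<longlonglongrightarrow> (\<integral>s. \<phi>' s t \<partial>M)" .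
  qed
  then show ?thesis
    by (simp add: has_field_derivative_iff)
qed

lemma unit_measure_Fubini:
  fixes \<phi> :: "real \<Rightarrow> real \<Rightarrow> real"
  assumes M: "unit_measure M" and N: "unit_measure N"
    and c: "continuous_on ({0..1} \<times> {0..1}) (\<lambda>(s, t). \<phi> s t)"
  shows "(\<integral>s. (\<integral>t. \<phi> s t \<partial>N) \<partial>M) = (\<integral>t. (\<integral>s. \<phi> s t \<partial>M) \<partial>N)"
proof -
  interpret M: finite_measure M using M by (rule unit_measure_finite)
  interpret N: finite_measure N using N by (rule unit_measure_finite)
  interpret P: pair_sigma_finite M N ..
  \<comment> \<open>retract the plane onto the unit square to get a Borel function on the whole plane\<close>
  define r where "r s = max 0 (min 1 s)" for s :: real
  have r: "r s \<in> {0..1}" "s \<in> {0..1} \<Longrightarrow> r s = s" for s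
    by (auto simp: r_def)
  have "continuous_on UNIV (\<lambda>z. (\<lambda>(s, t). \<phi> s t) (r (fst z), r (snd z)))"
    by (rule continuous_on_compose2[OF c]) (use r in \<open>auto simp: r_def intro!: continuous_intros\<close>)
  then have b: "(\<lambda>z. \<phi> (r (fst z)) (r (snd z))) \<in> borel_measurable borel"
    by (simp add: borel_measurable_continuous_onI)
  have id: "(\<lambda>s. s) \<in> borel_measurable M" "(\<lambda>s. s) \<in> borel_measurable N"
    using M N by (auto intro!: unit_measure_measurable)
  have "(\<lambda>z. (fst z, snd z)) \<in> M \<Otimes>\<^sub>M N \<rightarrow>\<^sub>M borel \<Otimes>\<^sub>M borel"
    using measurable_compose[OF measurable_fst id(1)] measurable_compose[OF measurable_snd id(2)]
    by (rule measurable_Pair)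
  then have "(\<lambda>z. z) \<in> M \<Otimes>\<^sub>M N \<rightarrow>\<^sub>M (borel :: (real \<times> real) measure)"
    by (simp add: borel_prod)
  from measurable_compose[OF this b]
  have meas: "(\<lambda>z. \<phi> (r (fst z)) (r (snd z))) \<in> borel_measurable (M \<Otimes>\<^sub>M N)" .
  have "bounded ((\<lambda>(s, t). \<phi> s t) ` ({0..1} \<times> {0..1}))"
    using c by (intro compact_imp_bounded compact_continuous_image) (auto intro: compact_Times)
  then obtain B where B: "\<And>s t. s \<in> {0..1} \<Longrightarrow> t \<in> {0..1} \<Longrightarrow> norm (\<phi> s t) \<le> B"
    unfolding bounded_iff by force
  have "finite_measure (M \<Otimes>\<^sub>M N)"
    by (rule finite_measure_pair_measure) unfold_locales
  then have "integrable (M \<Otimes>\<^sub>M N) (\<lambda>z. \<phi> (r (fst z)) (r (snd z)))"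
    using meas r B by (intro finite_measure.integrable_const_bound[where B = B]) auto
  then have "integrable (M \<Otimes>\<^sub>M N) (case_prod (\<lambda>s t. \<phi> (r s) (r t)))"
    by (simp add: case_prod_beta')
  note P.Fubini_integral[OF this]
  moreover have "(\<integral>t. (\<integral>s. \<phi> (r s) (r t) \<partial>M) \<partial>N) = (\<integral>t. (\<integral>s. \<phi> s t \<partial>M) \<partial>N)"
    by (intro Bochner_Integration.integral_cong refl) (use M N r in \<open>auto simp: unit_measure_space\<close>)
  moreover have "(\<integral>s. (\<integral>t. \<phi> (r s) (r t) \<partial>N) \<partial>M) = (\<integral>s. (\<integral>t. \<phi> s t \<partial>N) \<partial>M)"
    by (intro Bochner_Integration.integral_cong refl) (use M N r in \<open>auto simp: unit_measure_space\<close>)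
  ultimately show ?thesis by simp
qed

text \<open>The measure \<open>s dM(s)\<close> appears when an average over dilations of the coordinate \<open>x\<^sub>j\<close> is
  differentiated in \<open>x\<^sub>j\<close> itself.\<close>
lemma unit_measure_density_id:
  assumes M: "unit_measure M"
  shows "unit_measure (density M (\<lambda>s. ennreal s))"
    and "continuous_on {0..1} \<phi> \<Longrightarrow> (\<integral>s. \<phi> s \<partial>density M (\<lambda>s. ennreal s)) = (\<integral>s. s * \<phi> s \<partial>M)"
proof -
  have id: "(\<lambda>s. s) \<in> borel_measurable M"
    using M by (auto intro!: unit_measure_measurable)
  have sp: "space M = {0..1}" using M by (rule unit_measure_space)
  show "unit_measure (density M (\<lambda>s. ennreal s))"
    unfolding unit_measure_def
  proof
    have "emeasure (density M (\<lambda>s. ennreal s)) (space M) = (\<integral>\<^sup>+s. ennreal s \<partial>M)"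
      using id by (subst emeasure_density) (auto intro!: nn_integral_cong)
    also have "\<dots> = ennreal (\<integral>s. s \<partial>M)"
      using M sp by (intro nn_integral_eq_integral unit_measure_integrable) (auto intro!: AE_I2)
    finally show "finite_measure (density M (\<lambda>s. ennreal s))"
      by (intro finite_measureI) (simp add: space_density)
  qed (use M in \<open>simp add: unit_measure_def\<close>)
  assume "continuous_on {0..1} \<phi>"
  then show "(\<integral>s. \<phi> s \<partial>density M (\<lambda>s. ennreal s)) = (\<integral>s. s * \<phi> s \<partial>M)"
    using id sp M by (subst integral_density) (auto simp: unit_measure_measurable intro!: AE_I2)
qed

section \<open>Erdelyi-Kober measures\<close>

text \<open>The Erdelyi-Kober measure \<open>s\<^bsup>a-1\<^esup> (1 - s)\<^bsup>b-1\<^esup> ds / \<Gamma>(b)\<close> on the unit interval.  The values of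
  the density at the two end points are the conventional ones of \<open>0 powr x = 0\<close> and do not
  matter.\<close>
definition EK_measure :: "real \<Rightarrow> real \<Rightarrow> real measure" where
  "EK_measure a b = density (restrict_space lborel {0..1})
     (\<lambda>s. ennreal (s powr (a - 1) * (1 - s) powr (b - 1) / Gamma b))"

lemma
  assumes a: "a > 0" and b: "b > 0"
  shows unit_measure_EK: "unit_measure (EK_measure a b)"
    and has_integral_EK: "continuous_on {0..1} \<phi> \<Longrightarrow>
      ((\<lambda>s. s powr (a - 1) * (1 - s) powr (b - 1) * \<phi> s) has_integral
        Gamma b * (\<integral>s. \<phi> s \<partial>EK_measure a b)) {0..1}"
proof -
  define w where "w s = s powr (a - 1) * (1 - s) powr (b - 1) / Gamma b" for s :: real
  define L where "L = restrict_space lborel {0..1::real}"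
  have EK: "EK_measure a b = density L (\<lambda>s. ennreal (w s))"
    by (simp add: EK_measure_def w_def L_def)
  have G: "Gamma b > 0"
    using b by (rule Gamma_real_pos)
  have w0: "w s \<ge> 0" for s
    using G by (simp add: w_def)
  have "set_integrable lborel {0..1} (\<lambda>s. s powr (a - 1) * (1 - s) powr (b - 1))"
    using integrable_Beta[OF a b] .
  then have "set_integrable lborel {0..1} w"
    unfolding w_def by (rule set_integrable_divide) 
  then have wi: "integrable L w"
    by (simp add: L_def set_integrable_def integrable_restrict_space)
  have wm [measurable]: "w \<in> borel_measurable L"
    using wi by simp
  have sets: "sets L = sets (restrict_space borel {0..1})"
    unfolding L_def by (intro sets_restrict_space_cong) auto
  have "emeasure (density L (\<lambda>s. ennreal (w s))) (space L) = (\<integral>\<^sup>+s. ennreal (w s) \<partial>L)"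
    by (subst emeasure_density) (auto intro!: nn_integral_cong)
  also have "\<dots> = ennreal (\<integral>s. w s \<partial>L)"
    using wi w0 by (intro nn_integral_eq_integral) auto
  finally have "finite_measure (EK_measure a b)"
    unfolding EK by (intro finite_measureI) (simp add: space_density)
  then show unit: "unit_measure (EK_measure a b)"
    by (simp add: unit_measure_def EK sets)
  assume c: "continuous_on {0..1} \<phi>"
  have m [measurable]: "\<phi> \<in> borel_measurable L"
    using unit_measure_measurable[OF unit c] by (simp add: EK)
  have "integrable L (\<lambda>s. w s *\<^sub>R \<phi> s)"
    using unit_measure_integrable[OF unit c] w0 unfolding EK by (subst (asm) integrable_density) auto
  then have si: "set_integrable lborel {0..1} (\<lambda>s. w s * \<phi> s)"
    by (simp add: L_def set_integrable_def integrable_restrict_space)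
  have "(\<integral>s. \<phi> s \<partial>EK_measure a b) = (\<integral>s. w s *\<^sub>R \<phi> s \<partial>L)"
    unfolding EK using w0 by (subst integral_density) auto
  also have "\<dots> = (LINT s : {0..1} | lborel. w s * \<phi> s)"
    by (simp add: L_def integral_restrict_space set_lebesgue_integral_def)
  finally have "((\<lambda>s. w s * \<phi> s) has_integral (\<integral>s. \<phi> s \<partial>EK_measure a b)) {0..1}"
    using set_borel_integral_eq_integral[OF si] by (simp add: has_integral_integrable_integral)
  from has_integral_mult_right[OF this, of "Gamma b"]
  show "((\<lambda>s. s powr (a - 1) * (1 - s) powr (b - 1) * \<phi> s) has_integral
        Gamma b * (\<integral>s. \<phi> s \<partial>EK_measure a b)) {0..1}"
    using G by (simp add: w_def)
qed

lemma EK_moment: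
  assumes a: "a > 0" and b: "b > 0"
  shows "(\<integral>s. s ^ n \<partial>EK_measure a b) = Gamma (a + n) / Gamma (a + b + n)"
proof -
  have "((\<lambda>s. s powr (a - 1) * (1 - s) powr (b - 1) * s ^ n) has_integral
          Gamma b * (\<integral>s. s ^ n \<partial>EK_measure a b)) {0..1}"
    using a b by (intro has_integral_EK continuous_intros)
  moreover have "((\<lambda>s. s powr (a - 1) * (1 - s) powr (b - 1) * s ^ n) has_integral Beta (a + n) b) {0..1}"
  proof (rule has_integral_eq[OF _ has_integral_Beta_real[of "a + n" b]])
    fix s :: real assume "s \<in> {0..1}"
    then show "s powr (a + real n - 1) * (1 - s) powr (b - 1) =
        s powr (a - 1) * (1 - s) powr (b - 1) * s ^ n"
      by (cases "s = 0") (auto simp: powr_add[symmetric] powr_realpow[symmetric] algebra_simps)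
  qed (use a b in auto)
  ultimately have "Gamma b * (\<integral>s. s ^ n \<partial>EK_measure a b) = Beta (a + n) b"
    by (rule has_integral_unique)
  also have "\<dots> = Gamma b * (Gamma (a + n) / Gamma (a + b + n))"
    by (simp add: Beta_def add_ac)
  finally have eq: "Gamma b * (\<integral>s. s ^ n \<partial>EK_measure a b) = Gamma b * (Gamma (a + n) / Gamma (a + b + n))" .
  have "Gamma b \<noteq> 0"
    using Gamma_real_pos[OF b] by simp
  from mult_left_cancel[OF this] eq show ?thesis by (rule iffD1)
qed

text \<open>The semigroup law of the Erdelyi-Kober averages.  Both sides are continuous in \<open>\<phi>\<close> for
  uniform convergence, so by the Weierstrass theorem it suffices to compare moments, and there
  the Gamma factors telescope.\<close>
lemma EK_semigroup:
  fixes \<phi> :: "real \<Rightarrow> real"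
  assumes a: "a > 0" and b: "b > 0" and c: "c > 0" and \<phi>: "continuous_on {0..1} \<phi>"
  shows "(\<integral>s. (\<integral>t. \<phi> (s * t) \<partial>EK_measure (a + b) c) \<partial>EK_measure a b) =
         (\<integral>s. \<phi> s \<partial>EK_measure a (b + c))"
proof -
  let ?M = "EK_measure a b" and ?N = "EK_measure (a + b) c" and ?P = "EK_measure a (b + c)"
  have M: "unit_measure ?M" and N: "unit_measure ?N" and P: "unit_measure ?P"
    using a b c by (auto intro!: unit_measure_EK)
  have st: "s * t \<in> {0..1}" if "s \<in> {0..1}" "t \<in> {0..1}" for s t :: real
    using that by (auto intro: mult_le_one)
  have inner: "continuous_on {0..1} (\<lambda>s. \<integral>t. f (s * t) \<partial>?N)" if f: "continuous_on {0..1} f" for f :: "real \<Rightarrow> real"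
  proof (rule continuous_on_unit_measure[OF N compact_Icc])
    have "continuous_on ({0..1} \<times> {0..1}) (\<lambda>z. f (fst z * snd z))"
      by (rule continuous_on_compose2[OF f]) (auto intro!: continuous_intros mult_le_one)
    then show "continuous_on ({0..1} \<times> {0..1}) (\<lambda>(s, t). f (s * t))"
      by (simp add: case_prod_beta')
  qed
  have cst: "continuous_on {0..1} (\<lambda>t. f (s * t))" if f: "continuous_on {0..1} f" and s: "s \<in> {0..1}"
    for f :: "real \<Rightarrow> real" and s
    by (rule continuous_on_compose2[OF f]) (use s in \<open>auto intro!: continuous_intros mult_le_one\<close>)
  have poly: "(\<integral>s. (\<integral>t. p (s * t) \<partial>?N) \<partial>?M) = (\<integral>s. p s \<partial>?P)" if p: "real_polynomial_function p" for p
  proof -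
    obtain k n where k: "p = (\<lambda>x. \<Sum>i\<le>n. k i * x ^ i)"
      using real_polynomial_function_imp_sum[OF p] by auto
    have moments: "(\<integral>s. s ^ i \<partial>?M) * (\<integral>t. t ^ i \<partial>?N) = (\<integral>s. s ^ i \<partial>?P)" for i
    proof -
      have "Gamma (a + b + real i) > 0"
        using a b by (intro Gamma_real_pos) auto
      then have "Gamma (a + (b + real i)) \<noteq> 0"
        by (simp add: add.assoc)
      then show ?thesis
        using a b c by (simp add: EK_moment add.assoc)
    qed
    have "(\<integral>s. (\<integral>t. p (s * t) \<partial>?N) \<partial>?M) =
        (\<integral>s. (\<Sum>i\<le>n. k i * s ^ i * (\<integral>t. t ^ i \<partial>?N)) \<partial>?M)"
    proof (rule Bochner_Integration.integral_cong[OF refl])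
      fix s
      have "(\<integral>t. (\<Sum>i\<le>n. k i * s ^ i * t ^ i) \<partial>?N) = (\<Sum>i\<le>n. \<integral>t. k i * s ^ i * t ^ i \<partial>?N)"
        by (intro Bochner_Integration.integral_sum unit_measure_integrable[OF N] continuous_intros)
      then show "(\<integral>t. p (s * t) \<partial>?N) = (\<Sum>i\<le>n. k i * s ^ i * (\<integral>t. t ^ i \<partial>?N))"
        by (simp add: k power_mult_distrib mult.assoc)
    qed
    also have "\<dots> = (\<Sum>i\<le>n. \<integral>s. k i * s ^ i * (\<integral>t. t ^ i \<partial>?N) \<partial>?M)"
      by (intro Bochner_Integration.integral_sum unit_measure_integrable[OF M] continuous_intros)
    also have "\<dots> = (\<Sum>i\<le>n. k i * ((\<integral>s. s ^ i \<partial>?M) * (\<integral>t. t ^ i \<partial>?N)))"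
      by (simp add: mult.assoc)
    also have "\<dots> = (\<Sum>i\<le>n. k i * (\<integral>s. s ^ i \<partial>?P))"
      by (simp only: moments)
    also have "\<dots> = (\<integral>s. p s \<partial>?P)"
    proof -
      have "(\<integral>s. (\<Sum>i\<le>n. k i * s ^ i) \<partial>?P) = (\<Sum>i\<le>n. \<integral>s. k i * s ^ i \<partial>?P)"
        by (intro Bochner_Integration.integral_sum unit_measure_integrable[OF P] continuous_intros)
      then show ?thesis by (simp add: k)
    qed
    finally show ?thesis .
  qed
  have "\<exists>q. real_polynomial_function q \<and> (\<forall>s\<in>{0..1}. \<bar>\<phi> s - q s\<bar> < 1 / Suc n)" for n
  proof -
    have "0 < 1 / real (Suc n)" by simp
    then show ?thesis
    proof (rule Stone_Weierstrass_real_polynomial_function[OF compact_Icc \<phi>])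
      fix q assume "real_polynomial_function q" "\<And>s. s \<in> {0..1} \<Longrightarrow> \<bar>\<phi> s - q s\<bar> < 1 / real (Suc n)"
      then show ?thesis by (intro exI[of _ q] conjI ballI)
    qed
  qed
  from choice[OF allI[OF this]]
  obtain p where ex: "\<forall>n. real_polynomial_function (p n) \<and> (\<forall>s\<in>{0..1}. \<bar>\<phi> s - p n s\<bar> < 1 / Suc n)" ..
  have p: "real_polynomial_function (p n)" for n
    using ex[THEN spec, THEN conjunct1] .
  have p\<phi>: "\<bar>\<phi> s - p n s\<bar> < 1 / Suc n" if "s \<in> {0..1}" for n s
    using ex[THEN spec, THEN conjunct2, THEN bspec, OF that] .
  have pc: "continuous_on A (p n)" for n A
    using p[of n] unfolding real_polynomial_function_eq by (rule continuous_on_polymonial_function)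
  have lim: "(\<lambda>n. p n s) \<longlonglongrightarrow> \<phi> s" if "s \<in> {0..1}" for s
  proof (rule LIM_zero_cancel, rule Lim_null_comparison)
    show "(\<lambda>n. 1 / real (Suc n)) \<longlonglongrightarrow> 0"
      using LIMSEQ_inverse_real_of_nat by (simp add: inverse_eq_divide)
    show "\<forall>\<^sub>F n in sequentially. norm (p n s - \<phi> s) \<le> 1 / real (Suc n)"
      using p\<phi>[OF that] by (intro always_eventually) (auto simp: abs_minus_commute less_imp_le)
  qed
  have "bounded (\<phi> ` {0..1})"
    using \<phi> by (intro compact_imp_bounded compact_continuous_image) auto
  then obtain B where B: "\<And>s. s \<in> {0..1} \<Longrightarrow> norm (\<phi> s) \<le> B"
    unfolding bounded_iff by blast
  have pB: "\<bar>p n s\<bar> \<le> B + 1" if "s \<in> {0..1}" for n s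
  proof -
    have "\<bar>p n s\<bar> \<le> \<bar>\<phi> s\<bar> + \<bar>\<phi> s - p n s\<bar>" by simp
    moreover have "1 / real (Suc n) \<le> 1" by simp
    ultimately show ?thesis
      using B[OF that] p\<phi>[OF that, of n] by (simp only: real_norm_def)
  qed
  have "(\<lambda>n. \<integral>s. (\<integral>t. p n (s * t) \<partial>?N) \<partial>?M) \<longlonglongrightarrow> (\<integral>s. (\<integral>t. \<phi> (s * t) \<partial>?N) \<partial>?M)"
  proof (rule unit_measure_LIMSEQ[OF M])
    fix s :: real assume s: "s \<in> {0..1}"
    show "(\<lambda>n. \<integral>t. p n (s * t) \<partial>?N) \<longlonglongrightarrow> (\<integral>t. \<phi> (s * t) \<partial>?N)"
      by (rule unit_measure_LIMSEQ[OF N cst[OF pc s] cst[OF \<phi> s] lim[OF st[OF s]] pB[OF st[OF s]]])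
    show "\<bar>\<integral>t. p n (s * t) \<partial>?N\<bar> \<le> (\<integral>t. B + 1 \<partial>?N)" for n
    proof (rule integral_abs_bound_integral)
      show "integrable ?N (\<lambda>t. p n (s * t))" "integrable ?N (\<lambda>t. B + 1)"
        by (rule unit_measure_integrable[OF N] cst[OF pc s] continuous_on_const)+
      show "\<bar>p n (s * t)\<bar> \<le> B + 1" if "t \<in> space ?N" for t
        using that by (intro pB[OF st[OF s]]) (simp add: unit_measure_space[OF N])
    qed
  qed (rule inner[OF pc] inner[OF \<phi>])+
  moreover have "(\<lambda>n. \<integral>s. p n s \<partial>?P) \<longlonglongrightarrow> (\<integral>s. \<phi> s \<partial>?P)"
    by (rule unit_measure_LIMSEQ[OF P pc \<phi> lim pB])
  ultimately show ?thesis
    unfolding poly[OF p] by (rule LIMSEQ_unique)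
qed

text \<open>The fundamental theorem of calculus for \<open>s\<^bsup>a\<^esup> f(s)\<close>, whose derivative is the integrand times
  the weight \<open>s\<^bsup>a-1\<^esup>\<close> of the measure.\<close>
lemma EK_1_integral_derivative:
  fixes f f' :: "real \<Rightarrow> real"
  assumes a: "a > 0" and d: "\<And>s. s \<in> {0..1} \<Longrightarrow> (f has_real_derivative f' s) (at s within {0..1})"
    and c: "continuous_on {0..1} f'"
  shows "(\<integral>s. a * f s + s * f' s \<partial>EK_measure a 1) = f 1"
proof -
  have fc: "continuous_on {0..1} f"
    using d by (rule DERIV_continuous_on)
  have "((\<lambda>s. s powr (a - 1) * (1 - s) powr (1 - 1) * (a * f s + s * f' s)) has_integral
      Gamma 1 * (\<integral>s. a * f s + s * f' s \<partial>EK_measure a 1)) {0..1}"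
    by (rule has_integral_EK) (use a c fc in \<open>auto intro!: continuous_intros\<close>)
  moreover have "((\<lambda>s. s powr (a - 1) * (1 - s) powr (1 - 1) * (a * f s + s * f' s)) has_integral f 1) {0..1}"
  proof -
    have "((\<lambda>s. s powr (a - 1) * (1 - s) powr (1 - 1) * (a * f s + s * f' s)) has_integral
        1 powr a * f 1 - 0 powr a * f 0) {0..1}"
    proof (rule fundamental_theorem_of_calculus_interior)
      show "continuous_on {0..1} (\<lambda>s. s powr a * f s)"
        by (rule continuous_on_mult[OF continuous_on_powr' fc]) (use a in \<open>auto intro!: continuous_intros\<close>)
      fix s :: real assume s: "s \<in> {0<..<1}"
      have "(f has_real_derivative f' s) (at s within {0<..<1})"
        by (rule has_field_derivative_subset[OF d]) (use s in auto)
      then have "(f has_real_derivative f' s) (at s)"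
        using s at_within_open[of s "{0<..<1}"] by simp
      then have "((\<lambda>s. s powr a * f s) has_real_derivative
          (a * s powr (a - 1)) * f s + f' s * s powr a) (at s)"
        using s by (intro DERIV_mult has_real_derivative_powr) auto
      also have "(a * s powr (a - 1)) * f s + f' s * s powr a =
          s powr (a - 1) * (1 - s) powr (1 - 1) * (a * f s + s * f' s)"
      proof -
        define P where "P = s powr (a - 1)"
        have "s powr a = P * s"
          using s powr_add[of s "a - 1" 1] by (simp only: P_def diff_add_cancel powr_one') simp
        moreover have "(1 - s) powr (1 - 1) = 1"
          using s by simp
        moreover have "a * P * f s + f' s * (P * s) = P * 1 * (a * f s + s * f' s)"
          by algebra
        ultimately show ?thesis
          by (simp only: P_def[symmetric])
      qed
      finally show "((\<lambda>s. s powr a * f s) has_vector_derivative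
          s powr (a - 1) * (1 - s) powr (1 - 1) * (a * f s + s * f' s)) (at s)"
        by (simp add: has_real_derivative_iff_has_vector_derivative)
    qed auto
    then show ?thesis by simp
  qed
  ultimately have "Gamma 1 * (\<integral>s. a * f s + s * f' s \<partial>EK_measure a 1) = f 1"
    by (rule has_integral_unique)
  then show ?thesis by simp
qed

section \<open>Partial derivatives on a closed box\<close>

lemma coord_upd_nth [simp]: "coord_upd x j t $ k = (if k = j then t else x $ k)"
  by (simp add: coord_upd_def)

lemma coord_upd_same [simp]: "coord_upd (coord_upd x j t) j u = coord_upd x j u"
  by (simp add: vec_eq_iff)

lemma coord_upd_triv [simp]: "coord_upd x j (x $ j) = x"
  by (simp add: vec_eq_iff)

lemma continuous_on_coord_upd [continuous_intros]:
  fixes f :: "'a::topological_space \<Rightarrow> real^'m"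
  assumes "continuous_on S f" "continuous_on S g"
  shows "continuous_on S (\<lambda>z. coord_upd (f z) j (g z))"
  unfolding coord_upd_def
proof (rule continuous_on_vec_lambda)
  show "continuous_on S (\<lambda>z. if k = j then g z else f z $ k)" for k
    using assms by (cases "k = j") (auto intro!: continuous_intros)
qed

text \<open>A nondegenerate closed box, on which one-sided partial derivatives are unique.\<close>
locale box =
  fixes lo hi :: "real^'m"
  assumes lo_less_hi: "lo $ j < hi $ j"
begin

abbreviation "\<Omega> \<equiv> cbox lo hi"

text \<open>The range of the \<open>j\<close>-th coordinate on the box.\<close>
abbreviation "edge j \<equiv> {lo $ j..hi $ j}"

abbreviation "pd \<equiv> partial_deriv lo hi"

abbreviation "Ck k \<equiv> Ck_on_box k lo hi"

lemma edgeI: "x \<in> \<Omega> \<Longrightarrow> x $ j \<in> edge j"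
  by (simp add: mem_box_cart)

lemma coord_upd_in_box: "x \<in> \<Omega> \<Longrightarrow> t \<in> edge j \<Longrightarrow> coord_upd x j t \<in> \<Omega>"
  by (simp add: mem_box_cart)

lemma coord_upd_in_boxI: "x \<in> \<Omega> \<Longrightarrow> lo $ j \<le> t \<Longrightarrow> t \<le> hi $ j \<Longrightarrow> coord_upd x j t \<in> \<Omega>"
  by (simp add: mem_box_cart)

lemma continuous_on_line:
  assumes "continuous_on \<Omega> f" "x \<in> \<Omega>"
  shows "continuous_on (edge j) (\<lambda>t. f (coord_upd x j t))"
  using assms(2) by (intro continuous_on_compose2[OF assms(1)]) (auto intro!: continuous_intros coord_upd_in_boxI)

lemma partial_deriv_eqI:
  assumes x: "x \<in> \<Omega>" and d: "((\<lambda>t. f (coord_upd x j t)) has_real_derivative d) (at (x $ j) within edge j)"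
  shows "pd j f x = d"
  unfolding partial_deriv_def
  using d by (intro vector_derivative_within_closed_interval lo_less_hi edgeI[OF x])
    (simp add: has_real_derivative_iff_has_vector_derivative)

lemma partial_deriv_cong_line:
  assumes x: "x \<in> \<Omega>" and eq: "\<And>t. t \<in> edge j \<Longrightarrow> f (coord_upd x j t) = g (coord_upd x j t)"
  shows "pd j f x = pd j g x"
  unfolding partial_deriv_def
  by (rule vector_derivative_cong_eq) (use eq edgeI[OF x] in \<open>auto intro!: always_eventually\<close>)

lemma partial_deriv_cong:
  assumes "x \<in> \<Omega>" "\<And>y. y \<in> \<Omega> \<Longrightarrow> f y = g y"
  shows "pd j f x = pd j g x"
  using assms by (intro partial_deriv_cong_line) (auto simp: coord_upd_in_boxI)

lemma Ck_continuous: "Ck k f \<Longrightarrow> continuous_on \<Omega> f"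
  by (cases k) auto

lemma Ck_partial_deriv: "Ck (Suc k) f \<Longrightarrow> Ck k (pd j f)"
  by simp

lemma Ck_SucD:
  assumes f: "Ck (Suc k) f" and x: "x \<in> \<Omega>" and t: "t \<in> edge j"
  shows "((\<lambda>u. f (coord_upd x j u)) has_real_derivative pd j f (coord_upd x j t)) (at t within edge j)"
proof -
  let ?y = "coord_upd x j t"
  have "(\<lambda>u. f (coord_upd ?y j u)) differentiable (at (?y $ j) within edge j)"
    using f coord_upd_in_box[OF x t] by (simp del: coord_upd_nth coord_upd_same)
  then have "((\<lambda>u. f (coord_upd ?y j u)) has_vector_derivative pd j f ?y) (at (?y $ j) within edge j)"
    unfolding partial_deriv_def vector_derivative_works .
  then show ?thesis
    by (simp add: has_real_derivative_iff_has_vector_derivative)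
qed

lemma Ck_SucD_at:
  assumes "Ck (Suc k) f" "x \<in> \<Omega>"
  shows "((\<lambda>u. f (coord_upd x j u)) has_real_derivative pd j f x) (at (x $ j) within edge j)"
  using Ck_SucD[OF assms edgeI[OF assms(2)], of j] by simp

lemma Ck_cong: "(\<And>x. x \<in> \<Omega> \<Longrightarrow> f x = g x) \<Longrightarrow> Ck k f \<longleftrightarrow> Ck k g"
proof (induction k arbitrary: f g)
  case 0
  then show ?case by (simp cong: continuous_on_cong)
next
  case (Suc k)
  have "Ck k (pd j f) \<longleftrightarrow> Ck k (pd j g)" for j
    by (rule Suc.IH, rule partial_deriv_cong) (use Suc.prems in auto)
  moreover have "(\<lambda>t. f (coord_upd x j t)) differentiable (at (x $ j) within edge j) \<longleftrightarrow>
      (\<lambda>t. g (coord_upd x j t)) differentiable (at (x $ j) within edge j)" if "x \<in> \<Omega>" for x j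
  proof -
    have "f (coord_upd x j t) = g (coord_upd x j t)" if "t \<in> edge j" for t
      using Suc.prems coord_upd_in_box[OF \<open>x \<in> \<Omega>\<close> that] by blast
    then show ?thesis
      by (intro iffI; elim differentiable_transform_within[OF _ zero_less_one edgeI[OF \<open>x \<in> \<Omega>\<close>]]) auto
  qed
  moreover have "continuous_on \<Omega> f \<longleftrightarrow> continuous_on \<Omega> g"
    using Suc.prems by (rule continuous_on_cong[OF refl])
  ultimately show ?case by simp
qed

text \<open>Only the existence of candidates \<open>g j\<close> for the partial derivatives has to be exhibited;
  they need to agree with \<^const>\<open>partial_deriv\<close> on the box only.\<close>
lemma Ck_SucI:
  assumes c: "continuous_on \<Omega> f"
    and d: "\<And>j x. x \<in> \<Omega> \<Longrightarrow>
          ((\<lambda>t. f (coord_upd x j t)) has_real_derivative g j x) (at (x $ j) within edge j)"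
    and g: "\<And>j. Ck k (g j)"
  shows "Ck (Suc k) f"
proof -
  have "Ck k (pd j f) \<longleftrightarrow> Ck k (g j)" for j
    by (rule Ck_cong) (rule partial_deriv_eqI[OF _ d])
  then have "Ck k (pd j f)" for j
    using g by simp
  moreover have "(\<lambda>t. f (coord_upd x j t)) differentiable (at (x $ j) within edge j)" if "x \<in> \<Omega>" for x j
    using d[OF that, of j] unfolding has_real_derivative_iff_has_vector_derivative
    by (rule differentiableI_vector)
  ultimately show ?thesis using c by simp
qed

lemma Ck_Suc_imp_Ck: "Ck (Suc k) f \<Longrightarrow> Ck k f"
proof (induction k arbitrary: f)
  case (Suc k)
  show ?case
    by (rule Ck_SucI[OF Ck_continuous[OF Suc.prems] Ck_SucD_at[OF Suc.prems]
          Suc.IH[OF Ck_partial_deriv[OF Suc.prems]]])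
qed simp

lemma Ck_add: "Ck k f \<Longrightarrow> Ck k g \<Longrightarrow> Ck k (\<lambda>x. f x + g x)"
proof (induction k arbitrary: f g)
  case (Suc k)
  show ?case
  proof (rule Ck_SucI[where g = "\<lambda>j x. pd j f x + pd j g x"])
    show "continuous_on \<Omega> (\<lambda>x. f x + g x)"
      using Suc.prems[THEN Ck_continuous] by (intro continuous_intros)
    show "Ck k (\<lambda>x. pd j f x + pd j g x)" for j
      by (intro Suc.IH Suc.prems[THEN Ck_partial_deriv])
    show "((\<lambda>t. f (coord_upd x j t) + g (coord_upd x j t)) has_real_derivative pd j f x + pd j g x)
        (at (x $ j) within edge j)" if "x \<in> \<Omega>" for x j
      by (intro DERIV_add Suc.prems[THEN Ck_SucD_at] that)
  qed
qed (auto intro!: continuous_intros)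

lemma Ck_cmult: "Ck k f \<Longrightarrow> Ck k (\<lambda>x. c * f x)"
proof (induction k arbitrary: f)
  case (Suc k)
  show ?case
  proof (rule Ck_SucI[where g = "\<lambda>j x. c * pd j f x"])
    show "continuous_on \<Omega> (\<lambda>x. c * f x)"
      using Suc.prems[THEN Ck_continuous] by (intro continuous_intros)
    show "Ck k (\<lambda>x. c * pd j f x)" for j
      by (intro Suc.IH Suc.prems[THEN Ck_partial_deriv])
    show "((\<lambda>t. c * f (coord_upd x j t)) has_real_derivative c * pd j f x)
        (at (x $ j) within edge j)" if "x \<in> \<Omega>" for x j
      by (intro DERIV_cmult Suc.prems[THEN Ck_SucD_at] that)
  qed
qed (auto intro!: continuous_intros)

lemma Ck_coord_mult: "Ck k f \<Longrightarrow> Ck k (\<lambda>x. (x $ j - lo $ j) * f x)"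
proof (induction k arbitrary: f)
  case 0
  then show ?case by (auto intro!: continuous_intros)
next
  case (Suc k)
  show ?case
  proof (rule Ck_SucI[where g = "\<lambda>i x. (if i = j then 1 else 0) * f x + (x $ j - lo $ j) * pd i f x"])
    show "continuous_on \<Omega> (\<lambda>x. (x $ j - lo $ j) * f x)"
      using Ck_continuous[OF Suc.prems] by (auto intro!: continuous_intros)
    show "Ck k (\<lambda>x. (if i = j then 1 else 0) * f x + (x $ j - lo $ j) * pd i f x)" for i
      by (intro Ck_add Ck_cmult Suc.IH Ck_Suc_imp_Ck[OF Suc.prems] Ck_partial_deriv[OF Suc.prems])
    fix i x assume x: "x \<in> \<Omega>"
    note d = Ck_SucD_at[OF Suc.prems x, of i]
    have "((\<lambda>t. (coord_upd x i t $ j - lo $ j)) has_real_derivative (if i = j then 1 else 0)) (at (x $ i) within edge i)"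
      by (cases "i = j") (auto intro!: derivative_eq_intros)
    from DERIV_mult[OF this d]
    show "((\<lambda>t. (coord_upd x i t $ j - lo $ j) * f (coord_upd x i t)) has_real_derivative
        (if i = j then 1 else 0) * f x + (x $ j - lo $ j) * pd i f x) (at (x $ i) within edge i)"
      by (simp add: mult.commute)
  qed
qed

text \<open>Symmetry of second derivatives up to the boundary.  Writing \<open>f\<close> at \<open>x\<^sub>i = t\<close> as its value at
  \<open>x\<^sub>i = lo\<^sub>i\<close> plus the integral of \<open>\<partial>\<^sub>i f\<close> from \<open>lo\<^sub>i\<close> to \<open>t\<close>, differentiating under the integral
  sign in direction \<open>j\<close> and then with respect to \<open>t\<close> turns \<open>\<partial>\<^sub>i \<partial>\<^sub>j f\<close> into \<open>\<partial>\<^sub>j \<partial>\<^sub>i f\<close>.\<close>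
lemma partial_deriv_commute:
  assumes f: "Ck (Suc (Suc k)) f" and ij: "i \<noteq> j" and x: "x \<in> \<Omega>"
  shows "pd i (pd j f) x = pd j (pd i f) x"
proof -
  \<comment> \<open>the point of the plane through \<open>x\<close> with \<open>j\<close>-th coordinate \<open>u\<close> and \<open>i\<close>-th coordinate \<open>t\<close>\<close>
  define P where "P u t = coord_upd (coord_upd x j u) i t" for u t
  have P_in: "P u t \<in> \<Omega>" if "u \<in> edge j" "t \<in> edge i" for u t
    using that x by (auto simp: P_def intro!: coord_upd_in_boxI)
  have P_upd: "coord_upd (P u t) i t' = P u t'" "coord_upd (P u t) j u' = P u' t"
      "P u t $ i = t" "P u t $ j = u" for u t u' t'
    using ij by (auto simp: P_def vec_eq_iff)
  have Px: "P (x $ j) t = coord_upd x i t" for t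
    by (simp add: P_def)
  have c: "continuous_on (edge j \<times> edge i) (\<lambda>(u, t). g (P u t))" if "continuous_on \<Omega> g" for g :: "_ \<Rightarrow> real"
    unfolding case_prod_beta' P_def
    by (rule continuous_on_compose2[OF that]) (use x in \<open>auto intro!: continuous_intros coord_upd_in_boxI\<close>)
  have df: "((\<lambda>u. g (P u t)) has_real_derivative pd j g (P u t)) (at u within edge j)"
    if "Ck (Suc l) g" "u \<in> edge j" "t \<in> edge i" for g u t l
    using Ck_SucD_at[OF that(1) P_in[OF that(2,3)], of j] by (simp add: P_upd)
  have di: "((\<lambda>t. g (P u t)) has_real_derivative pd i g (P u t)) (at t within edge i)"
    if "Ck (Suc l) g" "u \<in> edge j" "t \<in> edge i" for g u t l
    using Ck_SucD_at[OF that(1) P_in[OF that(2,3)], of i] by (simp add: P_upd)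
  have f1: "Ck (Suc k) (pd i f)" "Ck (Suc k) (pd j f)" "Ck (Suc k) f"
    using Ck_partial_deriv[OF f] Ck_Suc_imp_Ck[OF f] by blast+
  have c2: "continuous_on \<Omega> (pd j (pd i f))"
    using Ck_continuous[OF Ck_partial_deriv[OF f1(1)]] .
  have ci: "continuous_on (edge i) (\<lambda>\<tau>. g (P u \<tau>))" if "continuous_on \<Omega> g" "u \<in> edge j" for g :: "_ \<Rightarrow> real" and u
    unfolding P_def by (rule continuous_on_line) (use that x in \<open>auto intro!: coord_upd_in_boxI\<close>)
  have FTC: "f (P u t) = f (P u (lo $ i)) + integral (cbox (lo $ i) t) (\<lambda>\<tau>. pd i f (P u \<tau>))"
    if u: "u \<in> edge j" and t: "t \<in> edge i" for u t
  proof -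
    have "((\<lambda>\<tau>. pd i f (P u \<tau>)) has_integral f (P u t) - f (P u (lo $ i))) {lo $ i..t}"
    proof (rule fundamental_theorem_of_calculus)
      fix \<tau> assume \<tau>: "\<tau> \<in> {lo $ i..t}"
      show "((\<lambda>t. f (P u t)) has_vector_derivative pd i f (P u \<tau>)) (at \<tau> within {lo $ i..t})"
        unfolding has_real_derivative_iff_has_vector_derivative[symmetric]
        by (rule has_field_derivative_subset[OF di[OF f u]]) (use \<tau> t in auto)
    qed (use t in auto)
    then show ?thesis by (simp add: integral_unique)
  qed
  have eq: "pd j f (P (x $ j) t) = pd j f (P (x $ j) (lo $ i)) + integral {lo $ i..t} (\<lambda>\<tau>. pd j (pd i f) (P (x $ j) \<tau>))"
    if t: "t \<in> edge i" for t
  proof -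
    have sub: "{lo $ i..t} \<subseteq> edge i" using t by auto
    have li: "lo $ i \<in> edge i" using lo_less_hi[of i] by simp
    have "((\<lambda>u. integral (cbox (lo $ i) t) (\<lambda>\<tau>. pd i f (P u \<tau>))) has_real_derivative
        integral (cbox (lo $ i) t) (\<lambda>\<tau>. pd j (pd i f) (P (x $ j) \<tau>))) (at (x $ j) within edge j)"
    proof (rule leibniz_rule_field_derivative)
      show "((\<lambda>u. pd i f (P u \<tau>)) has_real_derivative pd j (pd i f) (P u \<tau>)) (at u within edge j)"
        if "u \<in> edge j" "\<tau> \<in> cbox (lo $ i) t" for u \<tau>
        using df[OF f1(1) that(1), of \<tau>] sub that(2) by auto
      show "(\<lambda>\<tau>. pd i f (P u \<tau>)) integrable_on cbox (lo $ i) t" if "u \<in> edge j" for u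
        using continuous_on_subset[OF ci[OF Ck_continuous[OF f1(1)] that] sub]
        by (simp add: integrable_continuous_real)
      show "continuous_on (edge j \<times> cbox (lo $ i) t) (\<lambda>(u, \<tau>). pd j (pd i f) (P u \<tau>))"
        using sub by (intro continuous_on_subset[OF c[OF c2]]) auto
    qed (use x in \<open>auto simp: mem_box_cart\<close>)
    from DERIV_add[OF df[OF f edgeI[OF x] li] this]
    have "((\<lambda>u. f (P u t)) has_real_derivative pd j f (P (x $ j) (lo $ i)) +
        integral (cbox (lo $ i) t) (\<lambda>\<tau>. pd j (pd i f) (P (x $ j) \<tau>))) (at (x $ j) within edge j)"
      by (rule has_field_derivative_transform_within[OF _ zero_less_one edgeI[OF x]]) (rule FTC[OF _ t, symmetric])
    then have "((\<lambda>u. f (coord_upd (P (x $ j) t) j u)) has_real_derivative pd j f (P (x $ j) (lo $ i)) +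
        integral (cbox (lo $ i) t) (\<lambda>\<tau>. pd j (pd i f) (P (x $ j) \<tau>))) (at (P (x $ j) t $ j) within edge j)"
      by (simp only: P_upd)
    from partial_deriv_eqI[OF P_in[OF edgeI[OF x] t] this]
    show ?thesis by simp
  qed
  have "((\<lambda>t. integral {lo $ i..t} (\<lambda>\<tau>. pd j (pd i f) (P (x $ j) \<tau>))) has_real_derivative
      pd j (pd i f) (P (x $ j) (x $ i))) (at (x $ i) within edge i)"
    using ci[OF c2 edgeI[OF x]] edgeI[OF x] by (rule integral_has_real_derivative)
  from DERIV_add[OF DERIV_const[of "pd j f (P (x $ j) (lo $ i))"] this]
  have "((\<lambda>t. pd j f (P (x $ j) t)) has_real_derivative
      pd j (pd i f) (P (x $ j) (x $ i))) (at (x $ i) within edge i)"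
    unfolding add_0_left
    by (rule has_field_derivative_transform_within[OF _ zero_less_one edgeI[OF x]]) (rule eq[symmetric])
  then show ?thesis
    by (intro partial_deriv_eqI x) (simp add: Px)
qed

end

section \<open>Averages over contractions of a coordinate\<close>

text \<open>Contraction of the \<open>j\<close>-th coordinate towards \<open>lo\<^sub>j\<close> by the factor \<open>s\<close>.\<close>
definition scale_coord :: "real^'m \<Rightarrow> 'm \<Rightarrow> real \<Rightarrow> real^'m \<Rightarrow> real^'m" where
  "scale_coord lo j s x = coord_upd x j (lo $ j + s * (x $ j - lo $ j))"

text \<open>The average of \<open>f\<close> over the contractions of the \<open>j\<close>-th coordinate, with respect to \<open>M\<close>.\<close>
definition dil_avg :: "real measure \<Rightarrow> real^'m \<Rightarrow> 'm \<Rightarrow> (real^'m \<Rightarrow> real) \<Rightarrow> real^'m \<Rightarrow> real" where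
  "dil_avg M lo j f x = (\<integral>s. f (scale_coord lo j s x) \<partial>M)"

lemma scale_coord_scale_coord: "scale_coord lo j t (scale_coord lo j s x) = scale_coord lo j (s * t) x"
  by (simp add: scale_coord_def vec_eq_iff)

lemma scale_coord_commute:
  "i \<noteq> j \<Longrightarrow> scale_coord lo i s (scale_coord lo j t x) = scale_coord lo j t (scale_coord lo i s x)"
  by (simp add: scale_coord_def vec_eq_iff)

lemma scale_coord_1 [simp]: "scale_coord lo j 1 x = x"
  by (simp add: scale_coord_def)

context box
begin

abbreviation "T M \<equiv> dil_avg M lo"

lemma scale_in_edge:
  assumes "u \<in> edge j" "s \<in> {0..1}"
  shows "lo $ j + s * (u - lo $ j) \<in> edge j"
proof -
  have "s * (u - lo $ j) \<le> 1 * (u - lo $ j)" "0 \<le> s * (u - lo $ j)"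
    using assms by (intro mult_right_mono mult_nonneg_nonneg; simp)+
  then show ?thesis using assms by simp
qed

lemma scale_coord_in_box: "x \<in> \<Omega> \<Longrightarrow> s \<in> {0..1} \<Longrightarrow> scale_coord lo j s x \<in> \<Omega>"
  unfolding scale_coord_def by (intro coord_upd_in_box scale_in_edge edgeI)

lemma continuous_on_scale_coord [continuous_intros]:
  assumes "continuous_on S f" "continuous_on S g"
  shows "continuous_on S (\<lambda>z. scale_coord lo j (g z) (f z))"
  unfolding scale_coord_def using assms by (intro continuous_intros)

lemma continuous_on_dilation:
  assumes "continuous_on \<Omega> f"
  shows "continuous_on (\<Omega> \<times> {0..1}) (\<lambda>(x, s). f (scale_coord lo j s x))"
  unfolding case_prod_beta'
  by (rule continuous_on_compose2[OF assms]) (use scale_coord_in_box in \<open>auto intro!: continuous_intros\<close>)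

lemma continuous_on_dilation_line:
  assumes "continuous_on \<Omega> f" "x \<in> \<Omega>"
  shows "continuous_on {0..1} (\<lambda>s. f (scale_coord lo j s x))"
  by (rule continuous_on_compose2[OF assms(1)])
    (use scale_coord_in_box[OF assms(2)] in \<open>auto intro!: continuous_intros\<close>)

lemma dil_avg_integrable:
  fixes f :: "real^'m \<Rightarrow> real"
  assumes "unit_measure M" "continuous_on \<Omega> f" "x \<in> \<Omega>"
  shows "integrable M (\<lambda>s. f (scale_coord lo j s x))"
  by (rule unit_measure_integrable[OF assms(1) continuous_on_dilation_line[OF assms(2,3)]])

lemma dil_avg_continuous:
  assumes "unit_measure M" "continuous_on \<Omega> f"
  shows "continuous_on \<Omega> (T M j f)"
  unfolding dil_avg_def
  by (rule continuous_on_unit_measure[OF assms(1) compact_cbox continuous_on_dilation[OF assms(2)]])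

lemma dil_avg_cong:
  assumes "unit_measure M" "x \<in> \<Omega>" "\<And>y. y \<in> \<Omega> \<Longrightarrow> f y = g y"
  shows "T M j f x = T M j g x"
  unfolding dil_avg_def
  using scale_coord_in_box[OF assms(2)] assms(3)
  by (intro Bochner_Integration.integral_cong refl) (simp add: unit_measure_space[OF assms(1)])

lemma dil_avg_add:
  assumes "unit_measure M" "continuous_on \<Omega> f" "continuous_on \<Omega> g" "x \<in> \<Omega>"
  shows "T M j (\<lambda>y. f y + g y) x = T M j f x + T M j g x"
  unfolding dil_avg_def by (intro Bochner_Integration.integral_add dil_avg_integrable assms)

lemma dil_avg_cmult: "T M j (\<lambda>y. c * f y) x = c * T M j f x"
  unfolding dil_avg_def by (rule integral_mult_right_zero)

lemma dil_avg_commute: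
  assumes M: "unit_measure M" and N: "unit_measure N" and f: "continuous_on \<Omega> f"
    and ij: "i \<noteq> j" and x: "x \<in> \<Omega>"
  shows "T M i (T N j f) x = T N j (T M i f) x"
proof -
  have "continuous_on ({0..1} \<times> {0..1}) (\<lambda>(s, t). f (scale_coord lo j t (scale_coord lo i s x)))"
    unfolding case_prod_beta'
    by (rule continuous_on_compose2[OF f])
      (use scale_coord_in_box[OF scale_coord_in_box[OF x]] in \<open>auto intro!: continuous_intros\<close>)
  from unit_measure_Fubini[OF M N this]
  show ?thesis
    unfolding dil_avg_def by (simp add: scale_coord_commute[OF ij])
qed

lemma has_real_derivative_dil_avg:
  assumes M: "unit_measure M" and f: "Ck (Suc k) f" and ij: "i \<noteq> j" and x: "x \<in> \<Omega>"
  shows "((\<lambda>t. T M j f (coord_upd x i t)) has_real_derivative T M j (pd i f) x) (at (x $ i) within edge i)"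
proof -
  have sc: "scale_coord lo j s (coord_upd x i t) = coord_upd (scale_coord lo j s x) i t" for s t
    using ij by (simp add: scale_coord_def vec_eq_iff)
  have "((\<lambda>t. \<integral>s. f (scale_coord lo j s (coord_upd x i t)) \<partial>M) has_real_derivative
        (\<integral>s. pd i f (scale_coord lo j s (coord_upd x i (x $ i))) \<partial>M)) (at (x $ i) within edge i)"
  proof (rule has_real_derivative_unit_measure[OF M edgeI[OF x]])
    fix s t :: real assume st: "s \<in> {0..1}" "t \<in> edge i"
    show "((\<lambda>t. f (scale_coord lo j s (coord_upd x i t))) has_real_derivative
        pd i f (scale_coord lo j s (coord_upd x i t))) (at t within edge i)"
      unfolding sc by (rule Ck_SucD[OF f scale_coord_in_box[OF x st(1)] st(2)])
  next
    fix t :: real assume "t \<in> edge i"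
    then show "continuous_on {0..1} (\<lambda>s. f (scale_coord lo j s (coord_upd x i t)))"
      by (intro continuous_on_dilation_line Ck_continuous[OF f] coord_upd_in_box x)
  next
    show "continuous_on ({0..1} \<times> edge i) (\<lambda>(s, t). pd i f (scale_coord lo j s (coord_upd x i t)))"
      unfolding case_prod_beta'
      by (rule continuous_on_compose2[OF Ck_continuous[OF Ck_partial_deriv[OF f]]])
        (use scale_coord_in_box[OF coord_upd_in_box[OF x]] in \<open>auto intro!: continuous_intros\<close>)
  qed
  then show ?thesis by (simp add: dil_avg_def)
qed

lemma has_real_derivative_dil_avg_same:
  assumes M: "unit_measure M" and f: "Ck (Suc k) f" and x: "x \<in> \<Omega>"
  shows "((\<lambda>t. T M j f (coord_upd x j t)) has_real_derivative
          (\<integral>s. s * pd j f (scale_coord lo j s x) \<partial>M)) (at (x $ j) within edge j)"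
proof -
  have sc: "scale_coord lo j s (coord_upd x j t) = coord_upd x j (lo $ j + s * (t - lo $ j))" for s t
    by (simp add: scale_coord_def vec_eq_iff)
  have "((\<lambda>t. \<integral>s. f (scale_coord lo j s (coord_upd x j t)) \<partial>M) has_real_derivative
        (\<integral>s. s * pd j f (scale_coord lo j s (coord_upd x j (x $ j))) \<partial>M)) (at (x $ j) within edge j)"
  proof (rule has_real_derivative_unit_measure[OF M edgeI[OF x]])
    fix s t :: real assume st: "s \<in> {0..1}" "t \<in> edge j"
    let ?g = "\<lambda>t. lo $ j + s * (t - lo $ j)"
    have "((\<lambda>u. f (coord_upd x j u)) has_real_derivative pd j f (coord_upd x j (?g t))) (at (?g t) within ?g ` edge j)"
      by (rule has_field_derivative_subset[OF Ck_SucD[OF f x scale_in_edge[OF st(2,1)]]])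
        (use scale_in_edge[OF _ st(1)] in blast)
    moreover have "(?g has_real_derivative s) (at t within edge j)"
      by (auto intro!: derivative_eq_intros)
    ultimately have "((\<lambda>u. f (coord_upd x j u)) \<circ> ?g has_real_derivative
        pd j f (coord_upd x j (?g t)) * s) (at t within edge j)"
      by (rule DERIV_image_chain)
    then show "((\<lambda>t. f (scale_coord lo j s (coord_upd x j t))) has_real_derivative
        s * pd j f (scale_coord lo j s (coord_upd x j t))) (at t within edge j)"
      unfolding sc by (simp add: o_def mult.commute)
  next
    fix t :: real assume "t \<in> edge j"
    then show "continuous_on {0..1} (\<lambda>s. f (scale_coord lo j s (coord_upd x j t)))"
      by (intro continuous_on_dilation_line Ck_continuous[OF f] coord_upd_in_box x)
  next
    have "continuous_on ({0..1} \<times> edge j) (\<lambda>z. pd j f (scale_coord lo j (fst z) (coord_upd x j (snd z))))"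
      by (rule continuous_on_compose2[OF Ck_continuous[OF Ck_partial_deriv[OF f]]])
        (use scale_coord_in_box[OF coord_upd_in_box[OF x]] in \<open>auto intro!: continuous_intros\<close>)
    then show "continuous_on ({0..1} \<times> edge j) (\<lambda>(s, t). s * pd j f (scale_coord lo j s (coord_upd x j t)))"
      unfolding case_prod_beta' by (intro continuous_intros)
  qed
  then show ?thesis by (simp add: dil_avg_def)
qed

lemma Ck_dil_avg: "unit_measure M \<Longrightarrow> Ck k f \<Longrightarrow> Ck k (T M j f)"
proof (induction k arbitrary: f M)
  case 0
  then show ?case by (simp add: dil_avg_continuous)
next
  case (Suc k)
  note M = Suc.prems(1) and f = Suc.prems(2)
  let ?N = "density M (\<lambda>s. ennreal s)"
  show ?case
  proof (rule Ck_SucI[where g = "\<lambda>i. if i = j then T ?N j (pd j f) else T M j (pd i f)"])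
    show "continuous_on \<Omega> (T M j f)"
      by (rule dil_avg_continuous[OF M Ck_continuous[OF f]])
    show "Ck k (if i = j then T ?N j (pd j f) else T M j (pd i f))" for i
      using Suc.IH[OF M Ck_partial_deriv[OF f]] Suc.IH[OF unit_measure_density_id(1)[OF M] Ck_partial_deriv[OF f]]
      by simp
    fix i x assume x: "x \<in> \<Omega>"
    have "T ?N j (pd j f) x = (\<integral>s. s * pd j f (scale_coord lo j s x) \<partial>M)"
      unfolding dil_avg_def
      by (rule unit_measure_density_id(2)[OF M continuous_on_dilation_line[OF Ck_continuous[OF Ck_partial_deriv[OF f]] x]])
    then show "((\<lambda>t. T M j f (coord_upd x i t)) has_real_derivative
        (if i = j then T ?N j (pd j f) else T M j (pd i f)) x) (at (x $ i) within edge i)"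
      using has_real_derivative_dil_avg[OF M f _ x, of i j] has_real_derivative_dil_avg_same[OF M f x, of j]
      by simp
  qed
qed

section \<open>Riemann-Liouville operators as averages\<close>

text \<open>Riemann-Liouville integration of \<open>(x\<^sub>j - lo\<^sub>j)\<^bsup>a-1\<^esup> h\<close>, by the substitution
  \<open>t = lo\<^sub>j + s (x\<^sub>j - lo\<^sub>j)\<close>.  The values of \<open>F\<close> at the two end points are left free because a
  Riemann-Liouville derivative need not exist on the face \<open>x\<^sub>j = lo\<^sub>j\<close>.\<close>
lemma RL_integral_powr:
  assumes a: "a > 0" and b: "b > 0" and h: "continuous_on \<Omega> h" and x: "x \<in> \<Omega>" and xj: "lo $ j < x $ j"
    and F: "\<And>t. lo $ j < t \<Longrightarrow> t < x $ j \<Longrightarrow>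
              F (coord_upd x j t) = c * (t - lo $ j) powr (a - 1) * h (coord_upd x j t)"
  shows "RL_integral lo b j F x = c * (x $ j - lo $ j) powr (a + b - 1) * T (EK_measure a b) j h x"
proof -
  define L where "L = x $ j - lo $ j"
  have L: "L > 0" using xj by (simp add: L_def)
  let ?E = "T (EK_measure a b) j h x"
  let ?f = "\<lambda>s. s powr (a - 1) * (1 - s) powr (b - 1) * h (scale_coord lo j s x)"
  have "(?f has_integral Gamma b * ?E) (cbox 0 1)"
    using has_integral_EK[OF a b continuous_on_dilation_line[OF h x]] by (simp add: dil_avg_def)
  from has_integral_affinity[OF this, of "1 / L" "- lo $ j / L"]
  have 1: "((\<lambda>t. ?f (t / L - lo $ j / L)) has_integral L * (Gamma b * ?E)) ((\<lambda>s. L * s + lo $ j) ` {0..1})"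
    using L by simp
  have "(\<lambda>s. L * s + lo $ j) ` {0..1} = {lo $ j..x $ j}"
    using L by (subst image_affinity_atLeastAtMost) (auto simp: L_def)
  with 1 have "((\<lambda>t. ?f (t / L - lo $ j / L)) has_integral L * (Gamma b * ?E)) {lo $ j<..<x $ j}"
    by (simp add: has_integral_Icc_iff_Ioo)
  from has_integral_mult_right[OF this, of "c * L powr (a - 1) * L powr (b - 1)"]
  have "((\<lambda>t. F (coord_upd x j t) / (x $ j - t) powr (1 - b)) has_integral
      c * L powr (a - 1) * L powr (b - 1) * (L * (Gamma b * ?E))) {lo $ j<..<x $ j}"
  proof (rule has_integral_eq[rotated])
    fix t assume "t \<in> {lo $ j<..<x $ j}"
    then have t: "lo $ j < t" "t < x $ j" by auto
    have s: "t / L - lo $ j / L = (t - lo $ j) / L" "1 - (t - lo $ j) / L = (x $ j - t) / L"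
      using L by (simp_all add: diff_divide_distrib[symmetric] L_def field_simps)
    have sc: "scale_coord lo j ((t - lo $ j) / L) x = coord_upd x j t"
      using L by (simp add: scale_coord_def L_def)
    have p1: "((t - lo $ j) / L) powr (a - 1) * L powr (a - 1) = (t - lo $ j) powr (a - 1)"
      using L t by (simp add: powr_divide)
    have p2: "((x $ j - t) / L) powr (b - 1) * L powr (b - 1) = (x $ j - t) powr (b - 1)"
      using L t by (simp add: powr_divide)
    have p3: "y / (x $ j - t) powr (1 - b) = y * (x $ j - t) powr (b - 1)" for y
      using powr_minus_divide[of "x $ j - t" "1 - b"] by simp
    have "c * L powr (a - 1) * L powr (b - 1) * ?f (t / L - lo $ j / L) =
        c * (((t - lo $ j) / L) powr (a - 1) * L powr (a - 1)) *
          (((x $ j - t) / L) powr (b - 1) * L powr (b - 1)) * h (coord_upd x j t)"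
      unfolding s sc by (simp only: mult_ac)
    also have "\<dots> = F (coord_upd x j t) / (x $ j - t) powr (1 - b)"
      unfolding p1 p2 p3 F[OF t] by (simp only: mult_ac)
    finally show "c * L powr (a - 1) * L powr (b - 1) * ?f (t / L - lo $ j / L) =
        F (coord_upd x j t) / (x $ j - t) powr (1 - b)" .
  qed
  then have "integral {lo $ j..x $ j} (\<lambda>t. F (coord_upd x j t) / (x $ j - t) powr (1 - b)) =
      c * L powr (a - 1) * L powr (b - 1) * (L * (Gamma b * ?E))"
    unfolding has_integral_Icc_iff_Ioo[symmetric] by (rule integral_unique)
  moreover have "L powr (a - 1) * L powr (b - 1) * L = L powr (a + b - 1)"
    using L powr_add[of L "a - 1 + (b - 1)" 1] by (simp add: powr_add[symmetric])
  moreover have "Gamma b \<noteq> 0"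
    using Gamma_real_pos[OF b] by simp
  ultimately show ?thesis
    unfolding RL_integral_def L_def[symmetric] by (simp add: field_simps)
qed

lemma RL_integral_continuous:
  assumes b: "b > 0" and h: "continuous_on \<Omega> h" and x: "x \<in> \<Omega>" and xj: "lo $ j < x $ j"
    and F: "\<And>t. lo $ j < t \<Longrightarrow> t < x $ j \<Longrightarrow> F (coord_upd x j t) = c * h (coord_upd x j t)"
  shows "RL_integral lo b j F x = c * (x $ j - lo $ j) powr b * T (EK_measure 1 b) j h x"
  using RL_integral_powr[of 1 b h x j F c] assms by simp

lemma RL_integral_lower_face: "x $ j = lo $ j \<Longrightarrow> RL_integral lo b j F x = 0"
  by (simp add: RL_integral_def)

text \<open>The regular part of the Riemann-Liouville derivative of order \<open>1 - \<alpha>\<close>: for continuously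
  differentiable \<open>f\<close> that derivative is \<open>(x\<^sub>j - lo\<^sub>j)\<^bsup>\<alpha>-1\<^esup>\<close> times \<open>RL_avg \<alpha> j f\<close> off the face
  \<open>x\<^sub>j = lo\<^sub>j\<close>, and \<open>RL_avg \<alpha> j f\<close> is continuous on the whole box.\<close>
definition RL_avg :: "real \<Rightarrow> 'm \<Rightarrow> (real^'m \<Rightarrow> real) \<Rightarrow> real^'m \<Rightarrow> real" where
  "RL_avg \<alpha> j f = T (EK_measure 1 \<alpha>) j (\<lambda>x. \<alpha> * f x + (x $ j - lo $ j) * pd j f x)"

text \<open>The integral of order \<open>\<alpha>\<close> is \<open>(x\<^sub>j - lo\<^sub>j)\<^bsup>\<alpha>\<^esup>\<close> times an average; the product rule gives the
  two summands under the average in \<^const>\<open>RL_avg\<close>.\<close>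
lemma RL_deriv_eq_RL_avg:
  assumes \<alpha>: "0 < \<alpha>" "\<alpha> < 1" and h: "Ck (Suc k) h" and x: "x \<in> \<Omega>" and xj: "lo $ j < x $ j"
    and F: "\<And>t. t \<in> edge j \<Longrightarrow> F (coord_upd x j t) = c * h (coord_upd x j t)"
  shows "RL_deriv lo hi (1 - \<alpha>) j F x = c * (x $ j - lo $ j) powr (\<alpha> - 1) * RL_avg \<alpha> j h x"
proof -
  let ?M = "EK_measure 1 \<alpha>"
  have M: "unit_measure ?M" using \<alpha> by (intro unit_measure_EK) auto
  note ch = Ck_continuous[OF h] and cd = Ck_continuous[OF Ck_partial_deriv[OF h]]
  have fl: "\<lfloor>1 - \<alpha>\<rfloor> = 0" using \<alpha> by (simp add: floor_eq_iff)
  have I: "RL_integral lo \<alpha> j F (coord_upd x j t) = c * ((t - lo $ j) powr \<alpha> * T ?M j h (coord_upd x j t))"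
    if t: "t \<in> edge j" for t
  proof (cases "t = lo $ j")
    case True
    then show ?thesis by (simp add: RL_integral_lower_face)
  next
    case False
    have "RL_integral lo \<alpha> j F (coord_upd x j t) =
        c * (coord_upd x j t $ j - lo $ j) powr \<alpha> * T ?M j h (coord_upd x j t)"
      using t False \<alpha> F by (intro RL_integral_continuous ch coord_upd_in_box x) auto
    then show ?thesis by simp
  qed
  define D where "D = (\<integral>s. s * pd j h (scale_coord lo j s x) \<partial>?M)"
  define L where "L = x $ j - lo $ j"
  have L: "L > 0" using xj by (simp add: L_def)
  have "((\<lambda>t. (t - lo $ j) powr \<alpha>) has_real_derivative \<alpha> * L powr (\<alpha> - 1)) (at (x $ j) within edge j)"
    using xj by (auto intro!: derivative_eq_intros simp: L_def)
  from DERIV_mult[OF this has_real_derivative_dil_avg_same[OF M h x, of j]]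
  have "((\<lambda>t. c * ((t - lo $ j) powr \<alpha> * T ?M j h (coord_upd x j t))) has_real_derivative
      c * (\<alpha> * L powr (\<alpha> - 1) * T ?M j h x + D * L powr \<alpha>)) (at (x $ j) within edge j)"
    by (intro DERIV_cmult) (simp add: D_def L_def)
  then have "((\<lambda>t. RL_integral lo \<alpha> j F (coord_upd x j t)) has_real_derivative
      c * (\<alpha> * L powr (\<alpha> - 1) * T ?M j h x + D * L powr \<alpha>)) (at (x $ j) within edge j)"
    by (rule has_field_derivative_transform_within[OF _ zero_less_one edgeI[OF x]]) (rule I[symmetric])
  from partial_deriv_eqI[OF x this]
  have "RL_deriv lo hi (1 - \<alpha>) j F x = c * (\<alpha> * L powr (\<alpha> - 1) * T ?M j h x + D * L powr \<alpha>)"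
    by (simp add: RL_deriv_def fl)
  also have "L powr \<alpha> = L powr (\<alpha> - 1) * L"
    using powr_add[of L "\<alpha> - 1" 1] L by simp
  also have "c * (\<alpha> * L powr (\<alpha> - 1) * T ?M j h x + D * (L powr (\<alpha> - 1) * L)) =
      c * L powr (\<alpha> - 1) * (\<alpha> * T ?M j h x + L * D)"
    by algebra
  also have "L * D = T ?M j (\<lambda>y. (y $ j - lo $ j) * pd j h y) x"
    unfolding dil_avg_def D_def integral_mult_right_zero[symmetric]
    by (simp add: scale_coord_def L_def mult_ac)
  also have "\<alpha> * T ?M j h x + T ?M j (\<lambda>y. (y $ j - lo $ j) * pd j h y) x = RL_avg \<alpha> j h x"
    unfolding RL_avg_def dil_avg_cmult[symmetric]
    by (rule dil_avg_add[OF M _ _ x, symmetric]) (intro continuous_intros ch cd)+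
  finally show ?thesis by (simp only: L_def)
qed

lemma Ck_RL_avg:
  assumes "\<alpha> > 0" "Ck (Suc k) f"
  shows "Ck k (RL_avg \<alpha> j f)"
  unfolding RL_avg_def
  by (intro Ck_dil_avg unit_measure_EK Ck_add Ck_cmult Ck_coord_mult
      Ck_Suc_imp_Ck[OF assms(2)] Ck_partial_deriv[OF assms(2)] assms(1) zero_less_one)

lemma partial_deriv_RL_avg:
  assumes \<alpha>: "\<alpha> > 0" and f: "Ck (Suc (Suc k)) f" and ij: "i \<noteq> j" and x: "x \<in> \<Omega>"
  shows "pd i (RL_avg \<alpha> j f) x = RL_avg \<alpha> j (pd i f) x"
proof -
  have M: "unit_measure (EK_measure 1 \<alpha>)" using \<alpha> by (intro unit_measure_EK) auto
  let ?v = "\<lambda>x. \<alpha> * f x + (x $ j - lo $ j) * pd j f x"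
  have v: "Ck (Suc k) ?v"
    by (intro Ck_add Ck_cmult Ck_coord_mult Ck_Suc_imp_Ck[OF f] Ck_partial_deriv[OF f])
  have "pd i (RL_avg \<alpha> j f) x = T (EK_measure 1 \<alpha>) j (pd i ?v) x"
    unfolding RL_avg_def by (rule partial_deriv_eqI[OF x has_real_derivative_dil_avg[OF M v ij x]])
  also have "\<dots> = RL_avg \<alpha> j (pd i f) x"
    unfolding RL_avg_def
  proof (rule dil_avg_cong[OF M x])
    fix y assume y: "y \<in> \<Omega>"
    have "((\<lambda>t. \<alpha> * f (coord_upd y i t) + (y $ j - lo $ j) * pd j f (coord_upd y i t)) has_real_derivative
        \<alpha> * pd i f y + (y $ j - lo $ j) * pd i (pd j f) y) (at (y $ i) within edge i)"
      by (intro DERIV_add DERIV_cmult Ck_SucD_at[OF f y] Ck_SucD_at[OF Ck_partial_deriv[OF f] y])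
    then have "pd i ?v y = \<alpha> * pd i f y + (y $ j - lo $ j) * pd i (pd j f) y"
      using ij by (intro partial_deriv_eqI[OF y]) simp
    then show "pd i ?v y = \<alpha> * pd i f y + (y $ j - lo $ j) * pd j (pd i f) y"
      by (simp only: partial_deriv_commute[OF f ij y])
  qed
  finally show ?thesis .
qed

text \<open>In terms of regular parts, the Riemann-Liouville integral of order \<open>1 - \<alpha>\<close> is a left inverse
  of the derivative of the same order.  By the semigroup law the two averages compose to the one
  for \<open>EK_measure \<alpha> 1\<close>, which undoes \<open>\<alpha> f + (x\<^sub>j - lo\<^sub>j) \<partial>\<^sub>j f\<close>.\<close>
lemma dil_avg_RL_avg:
  assumes \<alpha>: "0 < \<alpha>" "\<alpha> < 1" and f: "Ck (Suc k) f" and x: "x \<in> \<Omega>"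
  shows "T (EK_measure \<alpha> (1 - \<alpha>)) j (RL_avg \<alpha> j f) x = f x"
proof -
  let ?v = "\<lambda>x. \<alpha> * f x + (x $ j - lo $ j) * pd j f x"
  note cf = Ck_continuous[OF f] and cd = Ck_continuous[OF Ck_partial_deriv[OF f]]
  have v: "continuous_on \<Omega> ?v"
    by (intro continuous_intros cf cd)
  have "T (EK_measure \<alpha> (1 - \<alpha>)) j (RL_avg \<alpha> j f) x =
      (\<integral>s. (\<integral>t. ?v (scale_coord lo j (s * t) x) \<partial>EK_measure (\<alpha> + (1 - \<alpha>)) \<alpha>) \<partial>EK_measure \<alpha> (1 - \<alpha>))"
    by (simp add: dil_avg_def RL_avg_def scale_coord_scale_coord)
  also have "\<dots> = (\<integral>s. ?v (scale_coord lo j s x) \<partial>EK_measure \<alpha> ((1 - \<alpha>) + \<alpha>))"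
    by (rule EK_semigroup[OF \<alpha>(1) _ \<alpha>(1) continuous_on_dilation_line[OF v x]]) (use \<alpha> in simp)
  also have "\<dots> = (\<integral>s. \<alpha> * f (scale_coord lo j s x) + s * ((x $ j - lo $ j) * pd j f (scale_coord lo j s x)) \<partial>EK_measure \<alpha> 1)"
    by (simp add: scale_coord_def mult_ac)
  also have "\<dots> = f (scale_coord lo j 1 x)"
  proof (rule EK_1_integral_derivative[OF \<alpha>(1)])
    show "continuous_on {0..1} (\<lambda>s. (x $ j - lo $ j) * pd j f (scale_coord lo j s x))"
      by (intro continuous_intros continuous_on_dilation_line[OF cd x])
    fix s :: real assume s: "s \<in> {0..1}"
    let ?g = "\<lambda>s. lo $ j + s * (x $ j - lo $ j)"
    have g: "?g s \<in> edge j" if "s \<in> {0..1}" for s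
      using scale_in_edge[OF edgeI[OF x] that] .
    have "((\<lambda>u. f (coord_upd x j u)) has_real_derivative pd j f (coord_upd x j (?g s))) (at (?g s) within ?g ` {0..1})"
      by (rule has_field_derivative_subset[OF Ck_SucD[OF f x g[OF s]]]) (use g in blast)
    moreover have "(?g has_real_derivative (x $ j - lo $ j)) (at s within {0..1})"
      by (auto intro!: derivative_eq_intros)
    ultimately have "((\<lambda>u. f (coord_upd x j u)) \<circ> ?g has_real_derivative
        pd j f (coord_upd x j (?g s)) * (x $ j - lo $ j)) (at s within {0..1})"
      by (rule DERIV_image_chain)
    then show "((\<lambda>s. f (scale_coord lo j s x)) has_real_derivative
        (x $ j - lo $ j) * pd j f (scale_coord lo j s x)) (at s within {0..1})"
      by (simp add: scale_coord_def o_def mult.commute)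
  qed
  finally show ?thesis by simp
qed

section \<open>Iterated integrals and derivatives\<close>

lemma partial_deriv_zero_on_line:
  assumes "x \<in> \<Omega>" "\<And>t. t \<in> edge i \<Longrightarrow> f (coord_upd x i t) = 0"
  shows "pd i f x = 0"
proof -
  have "pd i f x = pd i (\<lambda>_. 0) x"
    using assms by (intro partial_deriv_cong_line) auto
  also have "\<dots> = 0"
    by (rule partial_deriv_eqI[OF assms(1)]) simp
  finally show ?thesis .
qed

lemma RL_avg_cong:
  assumes \<alpha>: "\<alpha> > 0" and x: "x \<in> \<Omega>" and eq: "\<And>y. y \<in> \<Omega> \<Longrightarrow> f y = g y"
  shows "RL_avg \<alpha> j f x = RL_avg \<alpha> j g x"
  unfolding RL_avg_def
proof (rule dil_avg_cong[OF _ x])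
  show "unit_measure (EK_measure 1 \<alpha>)" using \<alpha> by (intro unit_measure_EK) auto
  fix y assume "y \<in> \<Omega>"
  then show "\<alpha> * f y + (y $ j - lo $ j) * pd j f y = \<alpha> * g y + (y $ j - lo $ j) * pd j g y"
    using eq partial_deriv_cong[of y f g j] by simp
qed

lemma Ck_foldr_RL_avg:
  assumes "\<alpha> > 0" "Ck (length J + k) f"
  shows "Ck k (foldr (RL_avg \<alpha>) J f)"
  using assms(2)
proof (induction J arbitrary: k)
  case (Cons j J)
  have "Ck (Suc k) (foldr (RL_avg \<alpha>) J f)"
    using Cons.prems by (intro Cons.IH) simp
  then show ?case
    by (simp add: Ck_RL_avg[OF assms(1)] del: Ck_on_box.simps)
qed simp

lemma partial_deriv_foldr_RL_avg:
  assumes \<alpha>: "\<alpha> > 0" and f: "Ck (length J + Suc k) f" and i: "i \<notin> set J" and x: "x \<in> \<Omega>"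
  shows "pd i (foldr (RL_avg \<alpha>) J f) x = foldr (RL_avg \<alpha>) J (pd i f) x"
  using f i x
proof (induction J arbitrary: x k)
  case (Cons j J)
  let ?g = "foldr (RL_avg \<alpha>) J f"
  have f': "Ck (length J + Suc (Suc k)) f"
    using Cons.prems(1) by simp
  have "pd i (RL_avg \<alpha> j ?g) x = RL_avg \<alpha> j (pd i ?g) x"
    using Cons.prems(2,3) by (intro partial_deriv_RL_avg[OF \<alpha> Ck_foldr_RL_avg[OF \<alpha> f']]) auto
  also have "\<dots> = RL_avg \<alpha> j (foldr (RL_avg \<alpha>) J (pd i f)) x"
    using Cons.prems(2) by (intro RL_avg_cong[OF \<alpha> Cons.prems(3)] Cons.IH[OF f']) auto
  finally show ?case by simp
qed simp

text \<open>The singular factor of the iterated Riemann-Liouville derivative in the coordinates \<open>S\<close>.\<close>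
abbreviation "weight \<alpha> S y \<equiv> (\<Prod>j\<in>S. (y $ j - lo $ j) powr (\<alpha> - 1))"

lemma weight_coord_upd: "i \<notin> S \<Longrightarrow> weight \<alpha> S (coord_upd y i t) = weight \<alpha> S y"
  by (rule prod.cong) auto

lemma foldr_RL_deriv:
  assumes \<alpha>: "0 < \<alpha>" "\<alpha> < 1" and J: "distinct J" and f: "Ck (length J + k) f"
    and x: "x \<in> \<Omega>" and xJ: "\<And>j. j \<in> set J \<Longrightarrow> lo $ j < x $ j"
  shows "foldr (RL_deriv lo hi (1 - \<alpha>)) J f x = weight \<alpha> (set J) x * foldr (RL_avg \<alpha>) J f x"
  using J f x xJ
proof (induction J arbitrary: x k)
  case (Cons j J)
  have f': "Ck (length J + Suc k) f"
    using Cons.prems(2) by simp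
  have j: "j \<notin> set J" "distinct J"
    using Cons.prems(1) by auto
  have "RL_deriv lo hi (1 - \<alpha>) j (foldr (RL_deriv lo hi (1 - \<alpha>)) J f) x =
      weight \<alpha> (set J) x * (x $ j - lo $ j) powr (\<alpha> - 1) * RL_avg \<alpha> j (foldr (RL_avg \<alpha>) J f) x"
  proof (rule RL_deriv_eq_RL_avg[OF \<alpha> Ck_foldr_RL_avg[OF \<alpha>(1) f'] Cons.prems(3)])
    show "lo $ j < x $ j" using Cons.prems(4) by simp
    fix t assume t: "t \<in> edge j"
    have "lo $ i < coord_upd x j t $ i" if "i \<in> set J" for i
      using that j Cons.prems(4) by auto
    from Cons.IH[OF j(2) f' coord_upd_in_box[OF Cons.prems(3) t] this]
    show "foldr (RL_deriv lo hi (1 - \<alpha>)) J f (coord_upd x j t) =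
        weight \<alpha> (set J) x * foldr (RL_avg \<alpha>) J f (coord_upd x j t)"
      by (simp only: weight_coord_upd[OF j(1)])
  qed
  then show ?case
    using j by (simp add: mult_ac)
qed simp

lemma partial_deriv_foldr_RL_deriv:
  assumes \<alpha>: "0 < \<alpha>" "\<alpha> < 1" and J: "distinct J" and f: "Ck (Suc (length J)) f" and i: "i \<notin> set J"
    and x: "x \<in> \<Omega>" and xJ: "\<And>j. j \<in> set J \<Longrightarrow> lo $ j < x $ j"
  shows "pd i (foldr (RL_deriv lo hi (1 - \<alpha>)) J f) x = weight \<alpha> (set J) x * foldr (RL_avg \<alpha>) J (pd i f) x"
proof -
  let ?g = "foldr (RL_avg \<alpha>) J f"
  have f': "Ck (length J + Suc 0) f" using f by simp
  have "pd i (foldr (RL_deriv lo hi (1 - \<alpha>)) J f) x = pd i (\<lambda>y. weight \<alpha> (set J) x * ?g y) x"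
  proof (rule partial_deriv_cong_line[OF x])
    fix t assume t: "t \<in> edge i"
    have "lo $ j < coord_upd x i t $ j" if "j \<in> set J" for j
      using that i xJ by auto
    from foldr_RL_deriv[OF \<alpha> J f' coord_upd_in_box[OF x t] this]
    show "foldr (RL_deriv lo hi (1 - \<alpha>)) J f (coord_upd x i t) = weight \<alpha> (set J) x * ?g (coord_upd x i t)"
      by (simp only: weight_coord_upd[OF i])
  qed
  also have "\<dots> = weight \<alpha> (set J) x * pd i ?g x"
    by (rule partial_deriv_eqI[OF x DERIV_cmult[OF Ck_SucD_at[OF Ck_foldr_RL_avg[OF \<alpha>(1) f'] x]]])
  finally show ?thesis
    by (simp only: partial_deriv_foldr_RL_avg[OF \<alpha>(1) f' i x])
qed

lemma foldr_dil_avg_continuous: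
  assumes "unit_measure M" "continuous_on \<Omega> h"
  shows "continuous_on \<Omega> (foldr (T M) K h)"
proof (induction K)
  case (Cons k K)
  show ?case unfolding foldr_Cons o_def by (rule dil_avg_continuous[OF assms(1) Cons.IH])
qed (use assms in simp)

lemma foldr_dil_avg_cong:
  assumes "unit_measure M" "x \<in> \<Omega>" "\<And>y. y \<in> \<Omega> \<Longrightarrow> f y = g y"
  shows "foldr (T M) K f x = foldr (T M) K g x"
  using assms(2)
proof (induction K arbitrary: x)
  case (Cons k K)
  then show ?case
    using dil_avg_cong[OF assms(1) Cons.prems Cons.IH] by simp
qed (use assms in simp)

lemma foldr_dil_avg_sum:
  assumes M: "unit_measure M" and h: "\<And>i. i \<in> I \<Longrightarrow> continuous_on \<Omega> (h i)" and x: "x \<in> \<Omega>"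
  shows "foldr (T M) K (\<lambda>y. \<Sum>i\<in>I. c i * h i y) x = (\<Sum>i\<in>I. c i * foldr (T M) K (h i) x)"
  using x
proof (induction K arbitrary: x)
  case (Cons k K)
  let ?h = "\<lambda>i. foldr (T M) K (h i)"
  have "T M k (foldr (T M) K (\<lambda>y. \<Sum>i\<in>I. c i * h i y)) x = T M k (\<lambda>y. \<Sum>i\<in>I. c i * ?h i y) x"
    by (rule dil_avg_cong[OF M Cons.prems Cons.IH])
  also have "\<dots> = (\<Sum>i\<in>I. T M k (\<lambda>y. c i * ?h i y) x)"
    unfolding dil_avg_def[of _ _ k]
    by (intro Bochner_Integration.integral_sum dil_avg_integrable[OF M _ Cons.prems] continuous_intros
        foldr_dil_avg_continuous[OF M] h)
  also have "\<dots> = (\<Sum>i\<in>I. c i * T M k (?h i) x)"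
    by (simp only: dil_avg_cmult)
  finally show ?case by simp
qed simp

lemma dil_avg_mult_invariant:
  assumes q: "\<And>y t. q (coord_upd y k t) = q y"
  shows "T M k (\<lambda>y. q y * h y) x = q x * T M k h x"
  unfolding dil_avg_def by (simp add: scale_coord_def q)

lemma foldr_dil_avg_mult_invariant:
  assumes M: "unit_measure M" and q: "\<And>k y t. k \<in> set K \<Longrightarrow> q (coord_upd y k t) = q y" and x: "x \<in> \<Omega>"
  shows "foldr (T M) K (\<lambda>y. q y * h y) x = q x * foldr (T M) K h x"
  using q x
proof (induction K arbitrary: x)
  case (Cons k K)
  have "T M k (foldr (T M) K (\<lambda>y. q y * h y)) x = T M k (\<lambda>y. q y * foldr (T M) K h y) x"
    using Cons.prems by (intro dil_avg_cong[OF M] Cons.IH) auto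
  then show ?case
    using dil_avg_mult_invariant[of q k M "foldr (T M) K h" x] Cons.prems(1) by simp
qed simp

text \<open>A factor that depends on one coordinate only passes through the averages in the others.\<close>
lemma foldr_dil_avg_extract:
  assumes M: "unit_measure M" and h: "continuous_on \<Omega> h" and qc: "continuous_on \<Omega> q"
    and q: "\<And>k y t. k \<noteq> i \<Longrightarrow> q (coord_upd y k t) = q y"
    and K: "distinct K" "i \<in> set K" and x: "x \<in> \<Omega>"
  shows "foldr (T M) K (\<lambda>y. q y * h y) x = T M i (\<lambda>y. q y * foldr (T M) (remove1 i K) h y) x"
  using K x
proof (induction K arbitrary: x)
  case (Cons k K)
  show ?case
  proof (cases "k = i")
    case True
    then have "T M i (foldr (T M) K (\<lambda>y. q y * h y)) x = T M i (\<lambda>y. q y * foldr (T M) K h y) x"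
      using Cons.prems by (intro dil_avg_cong[OF M] foldr_dil_avg_mult_invariant[OF M]) (auto intro!: q)
    then show ?thesis using True by simp
  next
    case False
    let ?g = "foldr (T M) (remove1 i K) h"
    have g: "continuous_on \<Omega> (\<lambda>y. q y * ?g y)"
      by (intro continuous_intros qc foldr_dil_avg_continuous[OF M h])
    have "T M k (foldr (T M) K (\<lambda>y. q y * h y)) x = T M k (T M i (\<lambda>y. q y * ?g y)) x"
      using Cons.prems False by (intro dil_avg_cong[OF M] Cons.IH) auto
    also have "\<dots> = T M i (T M k (\<lambda>y. q y * ?g y)) x"
      by (rule dil_avg_commute[OF M M g False Cons.prems(3)])
    also have "\<dots> = T M i (\<lambda>y. q y * T M k ?g y) x"
      by (intro dil_avg_cong[OF M Cons.prems(3)] dil_avg_mult_invariant q False)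
    finally show ?thesis using False by simp
  qed
qed simp

lemma foldr_dil_avg_rotate:
  assumes M: "unit_measure M" and h: "continuous_on \<Omega> h" and j: "j \<notin> set K" and x: "x \<in> \<Omega>"
  shows "T M j (foldr (T M) K h) x = foldr (T M) K (T M j h) x"
  using j x
proof (induction K arbitrary: x)
  case (Cons k K)
  have "T M j (T M k (foldr (T M) K h)) x = T M k (T M j (foldr (T M) K h)) x"
    using Cons.prems by (intro dil_avg_commute[OF M M foldr_dil_avg_continuous[OF M h]]) auto
  also have "\<dots> = T M k (foldr (T M) K (T M j h)) x"
    using Cons.prems by (intro dil_avg_cong[OF M] Cons.IH) auto
  finally show ?case by simp
qed simp

lemma foldr_dil_avg_foldr_RL_avg:
  assumes \<alpha>: "0 < \<alpha>" "\<alpha> < 1" and J: "distinct J" and f: "Ck (length J) f" and x: "x \<in> \<Omega>"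
  shows "foldr (T (EK_measure \<alpha> (1 - \<alpha>))) J (foldr (RL_avg \<alpha>) J f) x = f x"
  using J f x
proof (induction J arbitrary: x)
  case (Cons j J)
  let ?M = "EK_measure \<alpha> (1 - \<alpha>)" and ?u = "foldr (RL_avg \<alpha>) J f"
  have M: "unit_measure ?M" using \<alpha> by (intro unit_measure_EK) auto
  have j: "j \<notin> set J" "distinct J"
    using Cons.prems(1) by auto
  have f: "Ck (Suc (length J)) f" using Cons.prems(2) by simp
  have u: "Ck (Suc 0) ?u"
    by (rule Ck_foldr_RL_avg[OF \<alpha>(1)]) (use f in simp)
  have "T ?M j (foldr (T ?M) J (RL_avg \<alpha> j ?u)) x = foldr (T ?M) J (T ?M j (RL_avg \<alpha> j ?u)) x"
    by (rule foldr_dil_avg_rotate[OF M Ck_continuous[OF Ck_RL_avg[OF \<alpha>(1) u]] j(1) Cons.prems(3)])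
  also have "\<dots> = foldr (T ?M) J ?u x"
    by (rule foldr_dil_avg_cong[OF M Cons.prems(3) dil_avg_RL_avg[OF \<alpha> u]])
  also have "\<dots> = f x"
    by (rule Cons.IH[OF j(2) Ck_Suc_imp_Ck[OF f] Cons.prems(3)])
  finally show ?case by simp
qed simp

text \<open>Only the values off the lower faces enter the iterated integral.  In the induction \<open>S\<close> stays
  the full set of coordinates, while the factor \<open>c\<close>, independent of the coordinates in \<open>K\<close>,
  collects the weights of those already removed from \<open>K\<close>.\<close>
lemma foldr_RL_integral:
  assumes \<alpha>: "0 < \<alpha>" "\<alpha> < 1" and K: "distinct K" "set K \<subseteq> S" and h: "continuous_on \<Omega> h"
    and c: "\<And>k y t. k \<in> set K \<Longrightarrow> c (coord_upd y k t) = c y"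
    and F: "\<And>y. y \<in> \<Omega> \<Longrightarrow> (\<And>k. k \<in> S \<Longrightarrow> lo $ k < y $ k) \<Longrightarrow> F y = c y * weight \<alpha> (set K) y * h y"
    and x: "x \<in> \<Omega>" and xS: "\<And>k. k \<in> S \<Longrightarrow> lo $ k < x $ k"
  shows "foldr (RL_integral lo (1 - \<alpha>)) K F x = c x * foldr (T (EK_measure \<alpha> (1 - \<alpha>))) K h x"
  using K c F x xS
proof (induction K arbitrary: x c)
  case (Cons k K)
  let ?M = "EK_measure \<alpha> (1 - \<alpha>)"
  have M: "unit_measure ?M" using \<alpha> by (intro unit_measure_EK) auto
  have k: "k \<notin> set K" "distinct K" "set K \<subseteq> S" "k \<in> S"
    using Cons.prems(1,2) by auto
  define c' where "c' y = c y * (y $ k - lo $ k) powr (\<alpha> - 1)" for y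
  have IH: "foldr (RL_integral lo (1 - \<alpha>)) K F y = c' y * foldr (T ?M) K h y"
    if "y \<in> \<Omega>" "\<And>k. k \<in> S \<Longrightarrow> lo $ k < y $ k" for y
  proof (rule Cons.IH[OF k(2,3)])
    show "c' (coord_upd y i t) = c' y" if "i \<in> set K" for i y t
      using that k(1) Cons.prems(3)[of i y t] by (auto simp: c'_def)
    show "F y = c' y * weight \<alpha> (set K) y * h y" if "y \<in> \<Omega>" "\<And>k. k \<in> S \<Longrightarrow> lo $ k < y $ k" for y
      using Cons.prems(4)[OF that] k(1) by (simp add: c'_def mult_ac)
  qed (use that in auto)
  have "RL_integral lo (1 - \<alpha>) k (foldr (RL_integral lo (1 - \<alpha>)) K F) x =
      c x * (x $ k - lo $ k) powr (\<alpha> + (1 - \<alpha>) - 1) * T ?M k (foldr (T ?M) K h) x"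
  proof (rule RL_integral_powr[OF \<alpha>(1) _ foldr_dil_avg_continuous[OF M h] Cons.prems(5)])
    show "lo $ k < x $ k" using Cons.prems(6) k(4) by blast
    fix t assume t: "lo $ k < t" "t < x $ k"
    have "t \<in> edge k" using t edgeI[OF Cons.prems(5), of k] by auto
    moreover have "lo $ i < coord_upd x k t $ i" if "i \<in> S" for i
      using that t Cons.prems(6) by auto
    ultimately show "foldr (RL_integral lo (1 - \<alpha>)) K F (coord_upd x k t) =
        c x * (t - lo $ k) powr (\<alpha> - 1) * foldr (T ?M) K h (coord_upd x k t)"
      using IH[of "coord_upd x k t"] coord_upd_in_box[OF Cons.prems(5)] Cons.prems(3)[of k x t]
      by (simp add: c'_def)
  qed (use \<alpha> in simp)
  moreover have "x $ k - lo $ k \<noteq> 0"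
    using Cons.prems(6)[OF k(4)] by simp
  ultimately show ?case by simp
next
  case Nil
  then show ?case by simp
qed

lemma RL_integral_eq_0:
  assumes "\<And>t. t \<in> {lo $ i..x $ i} \<Longrightarrow> F (coord_upd x i t) = 0"
  shows "RL_integral lo b i F x = 0"
proof -
  have "integral {lo $ i..x $ i} (\<lambda>t. F (coord_upd x i t) / (x $ i - t) powr (1 - b)) =
      integral {lo $ i..x $ i} (\<lambda>t. 0)"
    using assms by (intro Henstock_Kurzweil_Integration.integral_cong) auto
  then show ?thesis by (simp add: RL_integral_def)
qed

lemma foldr_RL_integral_lower_face:
  "k \<in> set K \<Longrightarrow> x $ k = lo $ k \<Longrightarrow> foldr (RL_integral lo b) K F x = 0"
proof (induction K arbitrary: x)
  case (Cons i K)
  show ?case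
  proof (cases "k = i")
    case True
    then show ?thesis using Cons.prems by (simp add: RL_integral_lower_face)
  next
    case False
    then have "foldr (RL_integral lo b) K F (coord_upd x i t) = 0" for t
      using Cons.prems by (intro Cons.IH) auto
    then show ?thesis by (simp add: RL_integral_eq_0)
  qed
qed simp

lemma Caputo_deriv_eq:
  assumes "0 < \<alpha>" "\<alpha> < 1"
  shows "Caputo_deriv lo hi \<alpha> i f = RL_integral lo (1 - \<alpha>) i (pd i f)"
proof -
  have "\<lfloor>\<alpha>\<rfloor> = 0" using assms by (simp add: floor_eq_iff)
  then show ?thesis by (simp add: Caputo_deriv_def)
qed

lemma Caputo_deriv_lower_face:
  assumes \<alpha>: "0 < \<alpha>" "\<alpha> < 1" and x: "x \<in> \<Omega>" and k: "x $ k = lo $ k"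
    and f: "k \<noteq> i \<Longrightarrow> (\<And>y. y \<in> \<Omega> \<Longrightarrow> y $ k = lo $ k \<Longrightarrow> f y = 0)"
  shows "Caputo_deriv lo hi \<alpha> i f x = 0"
proof (cases "k = i")
  case True
  then show ?thesis using k by (simp add: Caputo_deriv_eq[OF \<alpha>] RL_integral_lower_face)
next
  case False
  have "pd i f (coord_upd x i t) = 0" if t: "t \<in> edge i" for t
    using k False by (intro partial_deriv_zero_on_line coord_upd_in_box x t f) (auto simp: coord_upd_in_boxI[OF x])
  moreover have "t \<in> edge i" if "t \<in> {lo $ i..x $ i}" for t
    using that edgeI[OF x, of i] by auto
  ultimately show ?thesis
    unfolding Caputo_deriv_eq[OF \<alpha>] by (intro RL_integral_eq_0) blast
qed

text \<open>The contribution of \<open>dx\<^sup>i \<and> dx\<^sup>J\<close> to the coefficient of \<open>dx\<^sup>K\<close>, where \<open>J\<close> is \<open>K\<close> without \<open>i\<close>.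
  The averages in \<open>J\<close> cancel the regular parts of the derivatives in \<open>J\<close>, and the power of
  \<open>x\<^sub>i - lo\<^sub>i\<close> turns the remaining average into an ordinary fractional integral.\<close>
lemma foldr_dil_avg_eq_Caputo_deriv:
  assumes \<alpha>: "0 < \<alpha>" "\<alpha> < 1" and K: "distinct K" "i \<in> set K" and f: "Ck (length K) f"
    and x: "x \<in> \<Omega>" and xi: "lo $ i < x $ i"
  shows "foldr (T (EK_measure \<alpha> (1 - \<alpha>))) K
           (\<lambda>y. (y $ i - lo $ i) powr (1 - \<alpha>) * foldr (RL_avg \<alpha>) (remove1 i K) (pd i f) y) x =
         Caputo_deriv lo hi \<alpha> i f x"
proof -
  let ?M = "EK_measure \<alpha> (1 - \<alpha>)" and ?J = "remove1 i K"
  let ?q = "\<lambda>y. (y $ i - lo $ i) powr (1 - \<alpha>)"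
  have M: "unit_measure ?M" using \<alpha> by (intro unit_measure_EK) auto
  have len: "Suc (length ?J) = length K"
    using K(2) length_pos_if_in_set[OF K(2)] by (simp add: length_remove1)
  have f1: "Ck (length ?J) (pd i f)"
    using f unfolding len[symmetric] by (rule Ck_partial_deriv)
  have cq: "continuous_on \<Omega> ?q"
    by (rule continuous_on_powr') (use \<alpha> in \<open>auto simp: mem_box_cart intro!: continuous_intros\<close>)
  have ch: "continuous_on \<Omega> (foldr (RL_avg \<alpha>) ?J (pd i f))"
    by (rule Ck_continuous[of 0], rule Ck_foldr_RL_avg) (use \<alpha> f1 in auto)
  have "foldr (T ?M) K (\<lambda>y. ?q y * foldr (RL_avg \<alpha>) ?J (pd i f) y) x =
      T ?M i (\<lambda>y. ?q y * foldr (T ?M) ?J (foldr (RL_avg \<alpha>) ?J (pd i f)) y) x"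
    by (rule foldr_dil_avg_extract[OF M ch cq _ K x]) simp
  also have "\<dots> = T ?M i (\<lambda>y. ?q y * pd i f y) x"
    using f1 K by (intro dil_avg_cong[OF M x]) (simp add: foldr_dil_avg_foldr_RL_avg[OF \<alpha>])
  also have "\<dots> = RL_integral lo (1 - \<alpha>) i (pd i f) x"
  proof -
    have "RL_integral lo (1 - \<alpha>) i (pd i f) x =
        1 * (x $ i - lo $ i) powr (\<alpha> + (1 - \<alpha>) - 1) * T ?M i (\<lambda>y. ?q y * pd i f y) x"
    proof (rule RL_integral_powr[OF \<alpha>(1) _ _ x xi])
      show "continuous_on \<Omega> (\<lambda>y. ?q y * pd i f y)"
        by (intro continuous_intros cq Ck_continuous[OF f1])
      fix t assume "lo $ i < t"
      then have "(t - lo $ i) powr (\<alpha> - 1) * (t - lo $ i) powr (1 - \<alpha>) = 1"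
        by (simp add: powr_add[symmetric])
      then show "pd i f (coord_upd x i t) =
          1 * (t - lo $ i) powr (\<alpha> - 1) * (?q (coord_upd x i t) * pd i f (coord_upd x i t))"
        by (simp add: mult.assoc[symmetric])
    qed (use \<alpha> in simp)
    then show ?thesis using xi by simp
  qed
  finally show ?thesis by (simp add: Caputo_deriv_eq[OF \<alpha>])
qed

end

section \<open>The factorization of the Caputo exterior derivative\<close>

lemma dx_coeff_nonzero:
  assumes "dx_coeff (i # J) K \<noteq> 0" "J \<in> incr_tuples p"
  shows "i \<notin> set J" "distinct J" "distinct K" "set K = insert i (set J)" "remove1 i K = J"
proof -
  have 1: "distinct (i # J)" "sort (i # J) = K"
    using assms(1) by (auto simp: dx_coeff_def split: if_splits)
  have "sorted J"
    using assms(2) by (simp add: incr_tuples_def strict_sorted_imp_sorted)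
  then have K: "K = insort i J"
    using 1(2) by (simp add: sorted_sort_id)
  show "i \<notin> set J" "distinct J" using 1(1) by auto
  show "distinct K" using 1 by (metis distinct_sort)
  show "set K = insert i (set J)" "remove1 i K = J"
    by (simp_all add: K set_insort_key remove1_insort_key)
qed

(* At a point with x^k = x^k_min for some k in K, the right-hand coefficient of dx^K is an
   integral over a degenerate interval, hence 0, whereas the left-hand one need not vanish.
   So coefficients are compared off those faces, and on all of Omega if every a_J vanishes
   on the faces x^j = x^j_min with j in J (no condition when p = 0). *)
theorem theorem1:
  fixes lo hi :: "real^'m::{finite,linorder}"
    and \<alpha> :: real and p :: nat and \<omega> :: "'m form"
  assumes "0 < \<alpha>" and "\<alpha> < 1"
    and "\<And>j. lo $ j < hi $ j"
    and "\<And>J. J \<in> incr_tuples p \<Longrightarrow> Ck_on_box (Suc p) lo hi (\<omega> J)"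
  shows "(\<forall>K\<in>incr_tuples (Suc p). \<forall>x\<in>cbox lo hi. (\<forall>k\<in>set K. lo $ k < x $ k) \<longrightarrow>
            Caputo_ext_deriv lo hi \<alpha> p \<omega> K x =
            RL_form_integral lo (1 - \<alpha>) (Suc p)
              (ext_deriv lo hi p (RL_form_deriv lo hi (1 - \<alpha>) p \<omega>)) K x) \<and>
         ((\<forall>J\<in>incr_tuples p. \<forall>x\<in>cbox lo hi. (\<exists>j\<in>set J. x $ j = lo $ j) \<longrightarrow> \<omega> J x = 0) \<longrightarrow>
          (\<forall>K\<in>incr_tuples (Suc p). \<forall>x\<in>cbox lo hi.
            Caputo_ext_deriv lo hi \<alpha> p \<omega> K x =
            RL_form_integral lo (1 - \<alpha>) (Suc p)
              (ext_deriv lo hi p (RL_form_deriv lo hi (1 - \<alpha>) p \<omega>)) K x))"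
proof -
  interpret box lo hi by unfold_locales (rule assms(3))
  note \<alpha> = assms(1,2)
  let ?F = "ext_deriv lo hi p (RL_form_deriv lo hi (1 - \<alpha>) p \<omega>)"
  let ?M = "EK_measure \<alpha> (1 - \<alpha>)"
  have M: "unit_measure ?M" using \<alpha> by (intro unit_measure_EK) auto
  have off_faces: "Caputo_ext_deriv lo hi \<alpha> p \<omega> K x = RL_form_integral lo (1 - \<alpha>) (Suc p) ?F K x"
    if K: "K \<in> incr_tuples (Suc p)" and x: "x \<in> cbox lo hi" and xK: "\<And>k. k \<in> set K \<Longrightarrow> lo $ k < x $ k"
    for K x
  proof -
    let ?I = "incr_tuples p \<times> UNIV"
    define c where "c = (\<lambda>(J, i). dx_coeff (i # J) K)"
    define h where "h = (\<lambda>(J, i) y. (y $ i - lo $ i) powr (1 - \<alpha>) * foldr (RL_avg \<alpha>) J (pd i (\<omega> J)) y)"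
    have lenK: "length K = Suc p" and dK: "distinct K"
      using K by (auto simp: incr_tuples_def strict_sorted_iff)
    have len: "length J = p" if "J \<in> incr_tuples p" for J :: "'m list"
      using that by (simp add: incr_tuples_def)
    have h: "continuous_on (cbox lo hi) (h e)" if "e \<in> ?I" for e
    proof -
      obtain J i where e: "e = (J, i)" by force
      have J: "J \<in> incr_tuples p" using that e by simp
      have "continuous_on (cbox lo hi) (\<lambda>y. (y $ i - lo $ i) powr (1 - \<alpha>))"
        by (rule continuous_on_powr') (use \<alpha> in \<open>auto simp: mem_box_cart intro!: continuous_intros\<close>)
      moreover have "Ck 0 (foldr (RL_avg \<alpha>) J (pd i (\<omega> J)))"
        by (rule Ck_foldr_RL_avg[OF \<alpha>(1)]) (use Ck_partial_deriv[OF assms(4)[OF J]] len[OF J] in simp)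
      ultimately show ?thesis
        unfolding h_def e by (auto intro!: continuous_intros)
    qed
    \<comment> \<open>\<open>dx\<^sup>i \<and> dx\<^sup>J\<close> carries the weight of \<open>J\<close> only; the power of \<open>x\<^sub>i - lo\<^sub>i\<close> in \<open>h\<close> compensates
      the missing factor, so that all terms share the weight of \<open>K\<close>\<close>
    have F: "?F K y = 1 * weight \<alpha> (set K) y * (\<Sum>e\<in>?I. c e * h e y)"
      if y: "y \<in> cbox lo hi" and yK: "\<And>k. k \<in> set K \<Longrightarrow> lo $ k < y $ k" for y
    proof -
      have "partial_deriv lo hi i (RL_form_deriv lo hi (1 - \<alpha>) p \<omega> J) y * dx_coeff (i # J) K =
          weight \<alpha> (set K) y * (c (J, i) * h (J, i) y)" if J: "J \<in> incr_tuples p" for J i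
      proof (cases "dx_coeff (i # J) K = 0")
        case True
        then show ?thesis by (simp add: c_def)
      next
        case False
        note d = dx_coeff_nonzero[OF False J]
        have "partial_deriv lo hi i (foldr (RL_deriv lo hi (1 - \<alpha>)) J (\<omega> J)) y =
            weight \<alpha> (set J) y * foldr (RL_avg \<alpha>) J (pd i (\<omega> J)) y"
          using assms(4)[OF J] yK d(4) unfolding len[OF J, symmetric]
          by (intro partial_deriv_foldr_RL_deriv[OF \<alpha> d(2) _ d(1) y]) auto
        moreover have "weight \<alpha> (set K) y * (y $ i - lo $ i) powr (1 - \<alpha>) = weight \<alpha> (set J) y"
        proof -
          have "y $ i - lo $ i > 0" using yK[of i] d(4) by simp
          then have "(y $ i - lo $ i) powr (\<alpha> - 1) * (y $ i - lo $ i) powr (1 - \<alpha>) = 1"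
            by (simp add: powr_add[symmetric])
          then show ?thesis
            using d(1) by (simp add: d(4) mult_ac) 
        qed
        ultimately show ?thesis
          using J by (simp add: RL_form_deriv_def c_def h_def mult_ac)
      qed
      then have "?F K y = (\<Sum>J\<in>incr_tuples p. \<Sum>i\<in>UNIV. weight \<alpha> (set K) y * (c (J, i) * h (J, i) y))"
        unfolding ext_deriv_def by (intro sum.cong refl)
      then show ?thesis
        by (simp add: sum.cartesian_product sum_distrib_left case_prod_beta')
    qed
    have "RL_form_integral lo (1 - \<alpha>) (Suc p) ?F K x = foldr (RL_integral lo (1 - \<alpha>)) K (?F K) x"
      using K by (simp add: RL_form_integral_def)
    also have "\<dots> = 1 * foldr (T ?M) K (\<lambda>y. \<Sum>e\<in>?I. c e * h e y) x"
      by (rule foldr_RL_integral[OF \<alpha> dK subset_refl _ _ F x xK]) (auto intro!: continuous_intros h)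
    also have "\<dots> = (\<Sum>e\<in>?I. c e * foldr (T ?M) K (h e) x)"
      using foldr_dil_avg_sum[OF M h x] by simp
    also have "\<dots> = (\<Sum>(J, i)\<in>?I. Caputo_deriv lo hi \<alpha> i (\<omega> J) x * dx_coeff (i # J) K)"
    proof (intro sum.cong refl, clarify)
      fix J :: "'m list" and i assume J: "J \<in> incr_tuples p"
      show "c (J, i) * foldr (T ?M) K (h (J, i)) x = Caputo_deriv lo hi \<alpha> i (\<omega> J) x * dx_coeff (i # J) K"
      proof (cases "dx_coeff (i # J) K = 0")
        case False
        note d = dx_coeff_nonzero[OF False J]
        have "foldr (T ?M) K (h (J, i)) x = Caputo_deriv lo hi \<alpha> i (\<omega> J) x"
          using foldr_dil_avg_eq_Caputo_deriv[OF \<alpha> dK, of i "\<omega> J" x] assms(4)[OF J] lenK x xK[of i] d(4,5)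
          by (simp add: h_def)
        then show ?thesis by (simp add: c_def)
      qed (simp add: c_def)
    qed
    also have "\<dots> = Caputo_ext_deriv lo hi \<alpha> p \<omega> K x"
      by (simp add: Caputo_ext_deriv_def sum.cartesian_product)
    finally show ?thesis by simp
  qed
  moreover have "Caputo_ext_deriv lo hi \<alpha> p \<omega> K x = RL_form_integral lo (1 - \<alpha>) (Suc p) ?F K x"
    if \<omega>: "\<forall>J\<in>incr_tuples p. \<forall>x\<in>cbox lo hi. (\<exists>j\<in>set J. x $ j = lo $ j) \<longrightarrow> \<omega> J x = 0"
      and K: "K \<in> incr_tuples (Suc p)" and x: "x \<in> cbox lo hi" for K x
  proof (cases "\<forall>k\<in>set K. lo $ k < x $ k")
    case True
    then show ?thesis using off_faces[OF K x] by blast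
  next
    case False
    \<comment> \<open>on such a face both sides vanish\<close>
    then obtain k where k: "k \<in> set K" "x $ k = lo $ k"
      using edgeI[OF x] by (auto simp: not_less intro: antisym)
    have "Caputo_deriv lo hi \<alpha> i (\<omega> J) x * dx_coeff (i # J) K = 0" if J: "J \<in> incr_tuples p" for J i
    proof (cases "dx_coeff (i # J) K = 0")
      case False
      note d = dx_coeff_nonzero[OF False J]
      have "Caputo_deriv lo hi \<alpha> i (\<omega> J) x = 0"
        by (rule Caputo_deriv_lower_face[OF \<alpha> x k(2)]) (use k(1) d(4) \<omega> J in auto)
      then show ?thesis by simp
    qed simp
    then have "Caputo_ext_deriv lo hi \<alpha> p \<omega> K x = 0"
      unfolding Caputo_ext_deriv_def by (intro sum.neutral ballI)
    moreover have "RL_form_integral lo (1 - \<alpha>) (Suc p) ?F K x = 0"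
      using K k by (simp add: RL_form_integral_def foldr_RL_integral_lower_face)
    ultimately show ?thesis by simp
  qed
  ultimately show ?thesis by blast
qed

end
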